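(* Let $N_1,N_2$ be two closed subspaces of a complex Hilbert space $H$ such that $N_1\cap N_2=\{0\}$. The following assertions are equivalent: 1. $(P_{N_2}P_{N_1})^n$ converges arbitrarily slowly to $0$; 2. $\|P_{N_2}P_{N_1}\|=1$; 3. $N_1^\perp+N_2^\perp$ is not closed; 4. $1\in\sigma(P_{N_2}P_{N_1})$; 5. $\cos(N_1,N_2)=1$; 6. $1\in\overline{W(P_{N_2}P_{N_1})}$; 7. there exists a sequence $(\lambda_n)_{n\in\mathbb{N}}$ in $[0,1)$ such that $\lim_n\lambda_n=1$ and, for every $n\in\mathbb{N}$, $\mathscr{E}(\lambda_n)\subset\overline{W(P_{N_2}P_{N_1})}$; 8. there does not exist $\theta<\frac{\pi}{6}$ such that $W(P_{N_2}P_{N_1})\subset\{z\in\mathbb{C}: |\arg(1-z)|\le\theta\}$.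
   Context: For a closed subspace $M$ of $H$, $P_M$ denotes the orthogonal projection of $H$ onto $M$ and $M^\perp$ its orthogonal complement. For a bounded operator $T$ on $H$, $\sigma(T)$ is its spectrum and $W(T)=\{\langle Tx,x\rangle : x\in H,\ \|x\|=1\}$ its numerical range; the overline is closure in $\mathbb{C}$. A sequence $T^n$ (converging strongly to $0$) converges arbitrarily slowly to $0$ if for every sequence $(a_n)_{n\ge1}$ of nonnegative reals with $a_n\to0$ there exists $x\in H$ such that $\|T^nx\|\ge a_n$ for all $n\ge1$. Since $N_1\cap N_2=\{0\}$, the cosine of the Friedrichs angle is $\cos(N_1,N_2)=\sup\{|\langle x,y\rangle| : x\in N_1,\ y\in N_2,\ \|x\|=\|y\|=1\}$ (the supremum of the empty set being $0$). For $\lambda\in[0,1]$, $\mathscr{E}(\lambda)\subset\mathbb{C}$ denotes the (closed) domain delimited by the ellipse with foci $0$ and $\lambda$ and minor axis (full) length $\sqrt{\lambda(1-\lambda)}$; that is, for $0<\lambda<1$, $\mathscr{E}(\lambda)=\{x+iy: x,y\in\mathbb{R},\ \frac{(x-\lambda/2)^2}{\lambda/4}+\frac{y^2}{\lambda(1-\lambda)/4}\le 1\}$, and $\mathscr{E}(0)=\{0\}$. $\arg$ is the principal argument in $(-\pi,\pi]$ (with the convention that $z=1$ belongs to every sector with $\theta\ge0$). *)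

theory Defs
  imports "HOL-Analysis.Analysis"
begin

text \<open>
  A complex Hilbert space is presented over its underlying real Hilbert space, whose inner product
  is the real part of the complex one. Norm and topology are thus those of the complex inner
  product, and its positive definiteness is inherited from \<^class>\<open>real_inner\<close> (see
  \<open>cinner_self\<close> below). The complex inner product is linear in its first argument.
\<close>

class chilbert_space = real_inner + complete_space +
  fixes scaleC :: "complex \<Rightarrow> 'a \<Rightarrow> 'a"  (infixr "*\<^sub>C" 75)
    and cinner :: "'a \<Rightarrow> 'a \<Rightarrow> complex"
  assumes scaleC_add_right: "c *\<^sub>C (x + y) = c *\<^sub>C x + c *\<^sub>C y"
    and scaleC_add_left: "(c + d) *\<^sub>C x = c *\<^sub>C x + d *\<^sub>C x"
    and scaleC_scaleC: "c *\<^sub>C (d *\<^sub>C x) = (c * d) *\<^sub>C x"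
    and scaleC_of_real: "complex_of_real r *\<^sub>C x = r *\<^sub>R x"
    and cinner_add_left: "cinner (x + y) z = cinner x z + cinner y z"
    and cinner_scaleC_left: "cinner (c *\<^sub>C x) y = c * cinner x y"
    and cinner_commute: "cinner x y = cnj (cinner y x)"
    and inner_eq_Re_cinner: "inner x y = Re (cinner x y)"

lemma cinner_self:
  fixes x :: "'a :: chilbert_space"
  shows "cinner x x = complex_of_real ((norm x)\<^sup>2)"
proof (rule complex_eqI)
  show "Re (cinner x x) = Re (complex_of_real ((norm x)\<^sup>2))"
    by (simp add: power2_norm_eq_inner inner_eq_Re_cinner)
  have "Im (cinner x x) = Im (cnj (cinner x x))"
    using cinner_commute[of x x] by (rule arg_cong)
  then show "Im (cinner x x) = Im (complex_of_real ((norm x)\<^sup>2))"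
    by simp
qed

instantiation complex :: chilbert_space
begin

definition scaleC_complex :: "complex \<Rightarrow> complex \<Rightarrow> complex"
  where "scaleC_complex c x = c * x"

definition cinner_complex :: "complex \<Rightarrow> complex \<Rightarrow> complex"
  where "cinner_complex x y = x * cnj y"

instance
  by standard
    (simp_all add: scaleC_complex_def cinner_complex_def inner_complex_def algebra_simps
      scaleR_conv_of_real)

end

definition closed_csubspace :: "'a :: chilbert_space set \<Rightarrow> bool"
  where "closed_csubspace M \<longleftrightarrow>
    closed M \<and> 0 \<in> M \<and> (\<forall>x\<in>M. \<forall>y\<in>M. x + y \<in> M) \<and> (\<forall>c. \<forall>x\<in>M. c *\<^sub>C x \<in> M)"

definition orth_compl :: "'a :: chilbert_space set \<Rightarrow> 'a set"
  where "orth_compl M = {x. \<forall>y\<in>M. cinner x y = 0}"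

text \<open>By the projection theorem the description below is unique and satisfiable for every \<open>x\<close>
  when \<open>M\<close> is a closed complex subspace; for other \<open>M\<close> the value is unspecified.\<close>

definition orth_proj :: "'a :: chilbert_space set \<Rightarrow> 'a \<Rightarrow> 'a"
  where "orth_proj M x = (THE y. y \<in> M \<and> x - y \<in> orth_compl M)"

definition bounded_clinear :: "('a :: chilbert_space \<Rightarrow> 'a) \<Rightarrow> bool"
  where "bounded_clinear T \<longleftrightarrow> bounded_linear T \<and> (\<forall>c x. T (c *\<^sub>C x) = c *\<^sub>C T x)"

definition spectrum :: "('a :: chilbert_space \<Rightarrow> 'a) \<Rightarrow> complex set"
  where "spectrum T = {c. \<not> (\<exists>S. bounded_clinear S \<and>
    (\<forall>x. S (T x - c *\<^sub>C x) = x) \<and> (\<forall>x. T (S x) - c *\<^sub>C S x = x))}"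

definition numerical_range :: "('a :: chilbert_space \<Rightarrow> 'a) \<Rightarrow> complex set"
  where "numerical_range T = {cinner (T x) x |x. norm x = 1}"

definition converges_arbitrarily_slowly_to_0 :: "('a :: chilbert_space \<Rightarrow> 'a) \<Rightarrow> bool"
  where "converges_arbitrarily_slowly_to_0 T \<longleftrightarrow>
    (\<forall>x. (\<lambda>n. (T ^^ n) x) \<longlonglongrightarrow> 0) \<and>
    (\<forall>a :: nat \<Rightarrow> real. (\<forall>n\<ge>1. 0 \<le> a n) \<and> a \<longlonglongrightarrow> 0 \<longrightarrow>
      (\<exists>x. \<forall>n\<ge>1. a n \<le> norm ((T ^^ n) x)))"

text \<open>This is the Friedrichs cosine only for subspaces with \<open>M \<inter> N = {0}\<close>; in general the
  vectors must also be taken orthogonal to \<open>M \<inter> N\<close>. The supremum of the empty set is \<open>0\<close>.\<close>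

definition cos_angle :: "'a :: chilbert_space set \<Rightarrow> 'a set \<Rightarrow> real"
  where "cos_angle M N =
    (let S = {cmod (cinner x y) |x y. x \<in> M \<and> y \<in> N \<and> norm x = 1 \<and> norm y = 1}
     in if S = {} then 0 else Sup S)"

text \<open>The closed elliptic domain with foci \<open>0\<close>, \<open>l\<close> and minor axis of full length
  \<open>sqrt (l * (1 - l))\<close>, for \<open>0 \<le> l \<le> 1\<close>. At \<open>l = 0\<close> and \<open>l = 1\<close> it degenerates to the segment
  between the foci, where the Cartesian equation would divide by \<open>0\<close>.\<close>

definition elliptic_domain :: "real \<Rightarrow> complex set"
  where "elliptic_domain l =
    (if l = 0 then {0}
     else if l = 1 then closed_segment 0 1
     else {Complex x y |x y. (x - l / 2)\<^sup>2 / (l / 4) + y\<^sup>2 / (l * (1 - l) / 4) \<le> 1})"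

definition all_equivalent :: "bool list \<Rightarrow> bool"
  where "all_equivalent Ps \<longleftrightarrow> (\<forall>P\<in>set Ps. \<forall>Q\<in>set Ps. P \<longleftrightarrow> Q)"

end

theory Submission
  imports Defs
begin

text \<open>
  Write \<open>P1\<close>, \<open>P2\<close> for the two projections and \<open>T = P2 P1\<close>. Call the subspaces separated when
  \<open>\<parallel>T x\<parallel> \<le> c \<parallel>x\<parallel>\<close> for some \<open>c < 1\<close>. Each of the eight assertions is shown to be
  equivalent to non-separation. If the subspaces are not separated, then \<open>N1\<close> contains unit
  vectors \<open>e\<close> with \<open>\<parallel>e - P2 e\<parallel>\<close> as small as desired (\<open>near_intersection\<close>), although
  \<open>N1 \<inter> N2 = {0}\<close>. Such vectors are almost fixed by \<open>T\<close>, which gives norm, spectrum and angle.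
  If the subspaces are separated, \<open>1 - T\<close> is bijective by the contraction principle; as
  \<open>1 - P2 P1 = (1 - P1) + (1 - P2) P1\<close>, the orthogonal complements then add up to the whole space.

  Slow convergence and non-closedness of the sum both follow from one gliding hump argument
  (\<open>gliding_hump\<close>), applied to powers of \<open>T\<close> and to the functionals \<open>\<langle>e\<^sub>k, \<cdot>\<rangle>\<close> respectively.
  That the powers of \<open>T\<close> tend to \<open>0\<close> strongly is von Neumann's alternating projection argument:
  \<open>T^n (1 - T) x\<close> tends to \<open>0\<close> and the range of \<open>1 - T\<close> is dense.

  For the numerical range, the compression \<open>A = P1 P2 P1\<close> is a positive contraction for which \<open>1\<close> is
  an approximate eigenvalue but not an eigenvalue. Hence approximate eigenvalues \<open>\<lambda> < 1\<close> of \<open>A\<close>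
  accumulate at \<open>1\<close> (\<open>approx_eigenvalue_near_bottom\<close>). For an
  approximate eigenvector \<open>e\<close>, the span of \<open>P1 e\<close> and \<open>P2 P1 e\<close> behaves like a plane in which
  \<open>P1\<close>, \<open>P2\<close> project onto two lines at an angle of squared cosine \<open>\<lambda>\<close>, and the numerical range of
  the product of two such projections is the elliptic domain of \<open>\<lambda>\<close>.

  The tangents from \<open>1\<close> to the ellipse of \<open>\<lambda>\<close> have slope \<open>\<plusminus> sqrt (\<lambda> / (4 - \<lambda>))\<close>, which tends to
  \<open>\<plusminus> tan (\<pi>/6)\<close> as \<open>\<lambda>\<close> tends to \<open>1\<close>; so a sector with \<open>\<theta> < \<pi>/6\<close> is impossible without
  separation. Conversely, with \<open>p = exp (\<plusminus> i \<pi>/3)\<close>, \<open>w = \<langle>T x, x\<rangle>\<close> and \<open>x\<close> of norm \<open>1\<close>, the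
  vector \<open>y = x - p P1 x - cnj p P2 x\<close> satisfies \<open>\<parallel>y\<parallel>\<^sup>2 = 1 + 2 Re (p\<^sup>2 w)\<close>: nonnegativity is the
  sector of angle \<open>\<pi>/6\<close>, and separation bounds \<open>\<parallel>y\<parallel>\<close> away from \<open>0\<close>, which shrinks the sector
  (\<open>numerical_range_gap\<close>).
\<close>

instance chilbert_space \<subseteq> banach ..

section \<open>Orthogonal decomposition and density\<close>

text \<open>
  A minimizing sequence for the distance from \<open>x\<close> to \<open>V\<close> is Cauchy by the parallelogram law, and
  the difference to the nearest point is orthogonal to \<open>V\<close>.
\<close>

lemma orthogonal_decomposition:
  fixes V :: "'a :: {real_inner, banach} set"
  assumes V: "subspace V" "closed V"
  shows "\<exists>y\<in>V. \<forall>v\<in>V. inner (x - y) v = 0"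
proof -
  define d where "d = infdist x V"
  have V0: "V \<noteq> {}" using subspace_0[OF V(1)] by auto
  have d_le: "d \<le> norm (x - v)" if "v \<in> V" for v
    using infdist_le[OF that, of x] by (simp add: d_def dist_norm)
  have d0: "0 \<le> d" by (simp add: d_def infdist_nonneg)
  have "\<exists>v\<in>V. norm (x - v) < d + 1 / real (Suc n)" for n
  proof (rule ccontr)
    assume "\<not> ?thesis"
    then have "\<And>v. v \<in> V \<Longrightarrow> d + 1 / real (Suc n) \<le> dist x v"
      by (force simp: dist_norm)
    then have "d + 1 / real (Suc n) \<le> infdist x V"
      by (subst infdist_notempty[OF V0]) (intro cINF_greatest[OF V0], auto)
    then show False by (simp add: d_def)
  qed
  then obtain v where v: "\<And>n. v n \<in> V" "\<And>n. norm (x - v n) < d + 1 / real (Suc n)"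
    by metis
  have par: "(norm (a - b))\<^sup>2 \<le> 2 * (norm (x - a))\<^sup>2 + 2 * (norm (x - b))\<^sup>2 - 4 * d\<^sup>2"
    if "a \<in> V" "b \<in> V" for a b
  proof -
    have "(1/2) *\<^sub>R (a + b) \<in> V"
      using that V(1) by (intro subspace_mul subspace_add)
    then have "d\<^sup>2 \<le> (norm (x - (1/2) *\<^sub>R (a + b)))\<^sup>2"
      using d_le d0 by (intro power_mono) auto
    also have "\<dots> = (1/2) * (norm (x - a))\<^sup>2 + (1/2) * (norm (x - b))\<^sup>2 - (1/4) * (norm (a - b))\<^sup>2"
      by (simp add: power2_norm_eq_inner algebra_simps inner_commute)
    finally show ?thesis by simp
  qed
  have lim: "(\<lambda>n. norm (x - v n)) \<longlonglongrightarrow> d"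
  proof (rule tendsto_sandwich[of "\<lambda>_. d" _ _ "\<lambda>n. d + 1 / real (Suc n)"])
    have "(\<lambda>n. d + 1 / real (Suc n)) \<longlonglongrightarrow> d + 0"
      by (intro tendsto_add tendsto_const lim_1_over_n LIMSEQ_Suc)
    then show "(\<lambda>n. d + 1 / real (Suc n)) \<longlonglongrightarrow> d" by simp
  qed (use v d_le in \<open>auto intro!: always_eventually less_imp_le\<close>)
  have "Cauchy v"
  proof (rule metric_CauchyI)
    fix e :: real assume "0 < e"
    have "(\<lambda>n. (norm (x - v n))\<^sup>2) \<longlonglongrightarrow> d\<^sup>2" by (intro tendsto_intros lim)
    then have "\<forall>\<^sub>F n in sequentially. (norm (x - v n))\<^sup>2 < d\<^sup>2 + e\<^sup>2 / 4"
      using \<open>0 < e\<close> by (intro order_tendstoD) auto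
    then obtain N where N: "\<And>n. n \<ge> N \<Longrightarrow> (norm (x - v n))\<^sup>2 < d\<^sup>2 + e\<^sup>2 / 4"
      by (auto simp: eventually_sequentially)
    show "\<exists>M. \<forall>m\<ge>M. \<forall>n\<ge>M. dist (v m) (v n) < e"
    proof (intro exI allI impI)
      fix m n assume mn: "m \<ge> N" "n \<ge> N"
      have "(norm (v m - v n))\<^sup>2 < e\<^sup>2"
        using par[OF v(1) v(1), of m n] N[OF mn(1)] N[OF mn(2)] by linarith
      then show "dist (v m) (v n) < e"
        using \<open>0 < e\<close> by (simp add: dist_norm power_less_imp_less_base)
    qed
  qed
  then obtain y where y: "v \<longlonglongrightarrow> y" using Cauchy_convergent convergent_def by blast
  have yV: "y \<in> V" using closed_sequentially[OF V(2)] v(1) y by blast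
  have "(\<lambda>n. norm (x - v n)) \<longlonglongrightarrow> norm (x - y)" by (intro tendsto_intros y)
  then have ny: "norm (x - y) = d" using lim LIMSEQ_unique by blast
  have "inner (x - y) w = 0" if w: "w \<in> V" for w
  proof (cases "w = 0")
    case False
    \<comment> \<open>Moving the nearest point along \<open>w\<close> by the optimal amount cannot decrease the distance.\<close>
    define t where "t = inner (x - y) w / inner w w"
    have ww: "inner w w > 0" using False by simp
    have "y + t *\<^sub>R w \<in> V" using yV w V(1) by (intro subspace_add subspace_mul)
    then have "(norm (x - y))\<^sup>2 \<le> (norm (x - (y + t *\<^sub>R w)))\<^sup>2"
      using d_le d0 ny by (intro power_mono) auto
    also have "\<dots> = (norm ((x - y) - t *\<^sub>R w))\<^sup>2" by (simp add: algebra_simps)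
    also have "\<dots> = (norm (x - y))\<^sup>2 - 2 * t * inner (x - y) w + t\<^sup>2 * inner w w"
      using dot_norm_neg[of "x - y" "t *\<^sub>R w"]
      by (simp add: power_mult_distrib power2_norm_eq_inner[of w])
    also have "\<dots> = (norm (x - y))\<^sup>2 - (inner (x - y) w)\<^sup>2 / inner w w"
      using ww by (simp add: t_def power2_eq_square field_simps)
    finally have "(inner (x - y) w)\<^sup>2 / inner w w \<le> 0" by simp
    then have "(inner (x - y) w)\<^sup>2 \<le> 0" using ww by (simp add: divide_le_0_iff)
    then show ?thesis by simp
  qed simp
  then show ?thesis using yV by blast
qed

lemma subspace_closure:
  fixes V :: "'a :: real_normed_vector set"
  assumes "subspace V"
  shows "subspace (closure V)"
proof (rule subspaceI)
  show "0 \<in> closure V" using subspace_0[OF assms] closure_subset by blast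
next
  fix x y assume "x \<in> closure V" "y \<in> closure V"
  then obtain f g where "\<And>n. f n \<in> V" "f \<longlonglongrightarrow> x" "\<And>n. g n \<in> V" "g \<longlonglongrightarrow> y"
    unfolding closure_sequential by blast
  then show "x + y \<in> closure V"
    unfolding closure_sequential
    by (intro exI[of _ "\<lambda>n. f n + g n"]) (auto intro: subspace_add[OF assms] tendsto_add)
next
  fix c x assume "x \<in> closure V"
  then obtain f where "\<And>n. f n \<in> V" "f \<longlonglongrightarrow> x"
    unfolding closure_sequential by blast
  then show "c *\<^sub>R x \<in> closure V"
    unfolding closure_sequential
    by (intro exI[of _ "\<lambda>n. c *\<^sub>R f n"]) (auto intro: subspace_scale[OF assms] tendsto_intros)
qed

lemma dense_if_trivial_orthogonal_complement:
  fixes V :: "'a :: {real_inner, banach} set"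
  assumes "subspace V" and "\<And>z. (\<And>v. v \<in> V \<Longrightarrow> inner z v = 0) \<Longrightarrow> z = 0"
  shows "closure V = UNIV"
proof -
  have "x \<in> closure V" for x
  proof -
    obtain y where y: "y \<in> closure V" "\<And>v. v \<in> closure V \<Longrightarrow> inner (x - y) v = 0"
      using orthogonal_decomposition[of "closure V" x] assms(1) by (auto simp: subspace_closure)
    then have "x - y = 0" using assms(2) closure_subset by blast
    then show ?thesis using y by simp
  qed
  then show ?thesis by auto
qed

section \<open>A gliding hump argument\<close>

text \<open>
  The vector is \<open>x = \<Sum>k. \<plusminus> 3^-k e\<^sub>k\<close>. Whatever has been chosen before stage \<open>k\<close>, one of the two
  signs makes \<open>S k\<close> of the partial sum at least as large as \<open>S k (3^-k e\<^sub>k)\<close>, that is at least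
  \<open>3/4\<close> of \<open>3^-k\<close>; the later terms have total norm at most half of \<open>3^-k\<close>. This is
  a form of the uniform boundedness principle with an explicit lower bound.
\<close>

lemma gliding_hump:
  fixes S :: "nat \<Rightarrow> 'a :: banach \<Rightarrow> 'b :: real_normed_vector"
  assumes lin: "\<And>k. linear (S k)" and contr: "\<And>k x. norm (S k x) \<le> norm x"
    and hump: "\<And>k. \<exists>e. norm e \<le> 1 \<and> 3/4 \<le> norm (S k e)"
  shows "\<exists>x. \<forall>k. (1/3) ^ k / 4 \<le> norm (S k x)"
proof -
  obtain e where e: "\<And>k. norm (e k) \<le> 1" "\<And>k. 3/4 \<le> norm (S k (e k))"
    using hump by metis
  define r :: "nat \<Rightarrow> real" where "r = (\<lambda>k. (1/3) ^ k)"
  have r0: "r k \<ge> 0" for k by (simp add: r_def)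
  have step: "\<exists>d. norm d \<le> r k \<and> 3/4 * r k \<le> norm (S k (x + d))" for k x
  proof -
    define f where "f = r k *\<^sub>R e k"
    have f: "norm f \<le> r k" "norm (- f) \<le> r k"
      using e(1)[of k] r0[of k] by (simp_all add: f_def mult_left_le)
    have "norm (S k f) = r k * norm (S k (e k))"
      using r0[of k] by (simp add: f_def linear_scale[OF lin])
    then have big: "3/4 * r k \<le> norm (S k f)"
      using e(2)[of k] r0[of k] mult_left_mono[of "3/4" "norm (S k (e k))" "r k"] by simp
    have "2 *\<^sub>R S k f = S k (x + f) - S k (x + (- f))"
      unfolding linear_add[OF lin] linear_neg[OF lin] scaleR_2 by simp
    then have "2 * norm (S k f) \<le> norm (S k (x + f)) + norm (S k (x + (- f)))"
      using norm_triangle_ineq4[of "S k (x + f)" "S k (x + (- f))"]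
      by (metis abs_numeral norm_scaleR)
    then have "3/4 * r k \<le> norm (S k (x + f)) \<or> 3/4 * r k \<le> norm (S k (x + (- f)))"
      using big by linarith
    then show ?thesis using f by blast
  qed
  then obtain D where D: "\<And>k x. norm (D k x) \<le> r k" "\<And>k x. 3/4 * r k \<le> norm (S k (x + D k x))"
    by metis
  define X where "X = rec_nat 0 (\<lambda>k x. x + D k x)"
  have X_Suc: "X (Suc k) = X k + D k (X k)" for k by (simp add: X_def)
  define d where "d = (\<lambda>k. D k (X k))"
  have X_sum: "X k = (\<Sum>j<k. d j)" for k
    by (induction k) (simp_all add: X_Suc d_def, simp add: X_def)
  have sr: "summable (\<lambda>j. r (j + n))" for n
    by (simp add: r_def power_add summable_mult2 summable_geometric)
  have sd: "summable (\<lambda>j. norm (d (j + n)))" for n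
    by (rule summable_comparison_test'[OF sr[of n]]) (simp add: d_def D(1))
  define x where "x = (\<Sum>j. d j)"
  have "(1/3) ^ k / 4 \<le> norm (S k x)" for k
  proof -
    define t where "t = (\<Sum>j. d (j + Suc k))"
    have "x = X (Suc k) + t"
      unfolding x_def t_def X_sum
      using suminf_split_initial_segment[OF summable_norm_cancel, of d "Suc k"] sd[of 0] by simp
    then have S: "S k x = S k (X (Suc k)) + S k t" by (simp add: linear_add[OF lin])
    have "norm t \<le> (\<Sum>j. norm (d (j + Suc k)))"
      unfolding t_def by (rule summable_norm[OF sd])
    also have "\<dots> \<le> (\<Sum>j. r (j + Suc k))"
      by (rule suminf_le[OF _ sd sr]) (simp add: d_def D(1))
    also have "\<dots> = r k / 2"
    proof -
      have "(\<lambda>j. r (j + Suc k)) = (\<lambda>j. (1/3) ^ Suc k * (1/3) ^ j)"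
        by (simp add: r_def power_add mult.commute)
      then show ?thesis
        using suminf_mult[of "\<lambda>j. (1/3 :: real) ^ j" "(1/3) ^ Suc k"]
        by (simp add: r_def summable_geometric suminf_geometric)
    qed
    finally have "norm (S k t) \<le> r k / 2" using contr[of k t] by linarith
    moreover have "3/4 * r k \<le> norm (S k (X (Suc k)))" using D(2) X_Suc by simp
    moreover have "norm (S k (X (Suc k))) - norm (S k t) \<le> norm (S k x)"
      unfolding S by (rule norm_diff_ineq)
    ultimately show ?thesis by (simp add: r_def)
  qed
  then show ?thesis by blast
qed

section \<open>Approximate eigenvalues of a positive operator near the bottom of its spectrum\<close>

text \<open>
  For the symmetric operators below these are exactly the points of the spectrum.
\<close>

definition approx_eigenvalue :: "('a :: real_normed_vector \<Rightarrow> 'a) \<Rightarrow> real \<Rightarrow> bool"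
  where "approx_eigenvalue B m \<longleftrightarrow> (\<forall>\<delta>>0. \<exists>x. norm x = 1 \<and> norm (B x - m *\<^sub>R x) \<le> \<delta>)"

lemma not_approx_eigenvalue_bounded_below:
  assumes "linear B" "\<not> approx_eigenvalue B m"
  shows "\<exists>k>0. \<forall>x. k * norm x \<le> norm (B x - m *\<^sub>R x)"
proof -
  obtain k where k: "k > 0" "\<And>x. norm x = 1 \<Longrightarrow> k \<le> norm (B x - m *\<^sub>R x)"
    using assms(2) unfolding approx_eigenvalue_def by force
  have "k * norm x \<le> norm (B x - m *\<^sub>R x)" for x
  proof (cases "x = 0")
    case False
    define a where "a = inverse (norm x)"
    have "B (a *\<^sub>R x) - m *\<^sub>R (a *\<^sub>R x) = a *\<^sub>R (B x - m *\<^sub>R x)"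
      by (simp add: linear_scale[OF assms(1)] scaleR_diff_right)
    then have "k \<le> a * norm (B x - m *\<^sub>R x)"
      using k(2)[of "a *\<^sub>R x"] False by (simp add: a_def)
    then show ?thesis using False by (simp add: a_def field_simps)
  qed simp
  then show ?thesis using k(1) by blast
qed

text \<open>
  The positive form \<open>\<langle>C x, y\<rangle>\<close> is a possibly degenerate inner product. Where it is
  nondegenerate in the direction \<open>y\<close> the usual minimization works; where \<open>\<langle>C y, y\<rangle> = 0\<close>, the form is
  affine along \<open>y\<close> and nonnegative, hence constant.
\<close>

lemma positive_form_Cauchy_Schwarz:
  fixes C :: "'a :: real_inner \<Rightarrow> 'a"
  assumes lin: "linear C" and sym: "\<And>x y. inner (C x) y = inner x (C y)"
    and pos: "\<And>x. 0 \<le> inner (C x) x"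
  shows "(inner (C x) y)\<^sup>2 \<le> inner (C x) x * inner (C y) y"
proof -
  have q: "0 \<le> inner (C x) x + 2 * t * inner (C x) y + t\<^sup>2 * inner (C y) y" for t
  proof -
    have "inner (C y) x = inner (C x) y" using sym[of x y] by (simp add: inner_commute)
    moreover have "0 \<le> inner (C (x + t *\<^sub>R y)) (x + t *\<^sub>R y)" by (rule pos)
    ultimately show ?thesis
      by (simp add: linear_add[OF lin] linear_scale[OF lin] inner_add_left inner_add_right
          algebra_simps power2_eq_square)
  qed
  show ?thesis
  proof (cases "inner (C y) y = 0")
    case True
    have "inner (C x) y = 0"
    proof (rule ccontr)
      assume n: "inner (C x) y \<noteq> 0"
      have "2 * (- (inner (C x) x + 1) / (2 * inner (C x) y)) * inner (C x) y
          = - (inner (C x) x + 1)"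
        using n by (simp add: field_simps)
      then show False
        using q[of "- (inner (C x) x + 1) / (2 * inner (C x) y)"]
        unfolding True by linarith
    qed
    then show ?thesis using True by simp
  next
    case False
    \<comment> \<open>The form \<open>q\<close> is evaluated at its minimizer.\<close>
    then have p: "inner (C y) y > 0" using pos[of y] by simp
    have "2 * (- inner (C x) y / inner (C y) y) * inner (C x) y
        = - 2 * ((inner (C x) y)\<^sup>2 / inner (C y) y)"
      "(- inner (C x) y / inner (C y) y)\<^sup>2 * inner (C y) y = (inner (C x) y)\<^sup>2 / inner (C y) y"
      using p by (simp_all add: field_simps power2_eq_square)
    then have "(inner (C x) y)\<^sup>2 / inner (C y) y \<le> inner (C x) x"
      using q[of "- inner (C x) y / inner (C y) y"] by linarith
    then show ?thesis using p by (simp add: field_simps)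
  qed
qed

text \<open>
  Let \<open>m\<close> be the infimum of \<open>\<langle>D x, x\<rangle>\<close> over unit vectors. Then \<open>C = D - m\<close> is positive, so its form
  satisfies the Cauchy-Schwarz inequality, which yields \<open>\<parallel>C x\<parallel>\<^sup>2 \<le> L \<langle>C x, x\<rangle>\<close> with \<open>L\<close> a bound for
  \<open>C\<close>. The right-hand side is small on unit vectors that nearly attain the infimum.
\<close>

lemma form_infimum_approx_eigenvalue:
  fixes D :: "'a :: real_inner \<Rightarrow> 'a"
  assumes bl: "bounded_linear D" and sym: "\<And>x y. inner (D x) y = inner x (D y)"
    and neg: "inner (D x0) x0 < 0"
  obtains m where "m < 0" "approx_eigenvalue D m"
proof -
  have lin: "linear D" using bl bounded_linear.linear by blast
  obtain K where K: "K > 0" "\<And>x. norm (D x) \<le> norm x * K"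
    using bounded_linear.pos_bounded[OF bl] by blast
  define Q where "Q = {inner (D x) x |x. norm x = 1}"
  have x0: "x0 \<noteq> 0" using neg by auto
  define u where "u = inverse (norm x0) *\<^sub>R x0"
  have u: "norm u = 1" "inner (D u) u < 0"
    using x0 neg by (simp_all add: u_def linear_scale[OF lin] mult_pos_neg)
  have "- K \<le> q" if "q \<in> Q" for q
  proof -
    obtain x where x: "norm x = 1" "q = inner (D x) x" using \<open>q \<in> Q\<close> by (auto simp: Q_def)
    then show ?thesis using Cauchy_Schwarz_ineq2[of "D x" x] K(2)[of x] by simp
  qed
  then have bdd: "bdd_below Q" by (rule bdd_belowI)
  define m where "m = Inf Q"
  have m_le: "m \<le> inner (D x) x" if "norm x = 1" for x
    unfolding m_def using that bdd by (intro cInf_lower) (auto simp: Q_def)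
  have m0: "m < 0" using m_le[OF u(1)] u(2) by linarith
  have m_form: "m * (norm x)\<^sup>2 \<le> inner (D x) x" for x
  proof (cases "x = 0")
    case False
    have "m \<le> inner (D (inverse (norm x) *\<^sub>R x)) (inverse (norm x) *\<^sub>R x)"
      using False by (intro m_le) simp
    also have "\<dots> = inner (D x) x / (norm x)\<^sup>2"
      by (simp add: linear_scale[OF lin] power2_eq_square divide_inverse)
    finally show ?thesis using False by (simp add: field_simps)
  qed simp
  define C where "C = (\<lambda>x. D x - m *\<^sub>R x)"
  have Cbl: "bounded_linear C"
    unfolding C_def by (intro bounded_linear_sub bl bounded_linear_scaleR_right)
  have Clin: "linear C" using Cbl bounded_linear.linear by blast
  have Csym: "inner (C x) y = inner x (C y)" for x y
    by (simp add: C_def inner_diff_left inner_diff_right sym)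
  have Cpos: "0 \<le> inner (C x) x" for x
    using m_form[of x] by (simp add: C_def inner_diff_left power2_norm_eq_inner)
  obtain L where L: "L > 0" "\<And>x. norm (C x) \<le> norm x * L"
    using bounded_linear.pos_bounded[OF Cbl] by blast
  have small: "(norm (C x))\<^sup>2 \<le> inner (C x) x * L" for x
  proof (cases "C x = 0")
    case False
    have "((norm (C x))\<^sup>2)\<^sup>2 \<le> inner (C x) x * inner (C (C x)) (C x)"
      using positive_form_Cauchy_Schwarz[OF Clin Csym Cpos, of x "C x"]
      by (simp add: power2_norm_eq_inner)
    also have "inner (C (C x)) (C x) \<le> norm (C x) * L * norm (C x)"
      using norm_cauchy_schwarz[of "C (C x)" "C x"] mult_right_mono[OF L(2)[of "C x"], of "norm (C x)"]
      by simp
    finally have "((norm (C x))\<^sup>2)\<^sup>2 \<le> inner (C x) x * (norm (C x) * L * norm (C x))"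
      using Cpos[of x] by (simp add: mult_left_mono)
    then have "(norm (C x))\<^sup>2 * (norm (C x))\<^sup>2 \<le> (inner (C x) x * L) * (norm (C x))\<^sup>2"
      by (simp add: power2_eq_square algebra_simps)
    then show ?thesis using False by (simp only: mult_le_cancel_right) simp
  qed (use L Cpos[of x] in simp)
  have "approx_eigenvalue D m"
    unfolding approx_eigenvalue_def
  proof (intro allI impI)
    fix \<delta> :: real assume d: "\<delta> > 0"
    have "m < m + \<delta>\<^sup>2 / L" using d L by simp
    moreover have "Q \<noteq> {}" using u by (auto simp: Q_def)
    ultimately obtain q where "q \<in> Q" "q < m + \<delta>\<^sup>2 / L"
      using cInf_lessD unfolding m_def by blast
    then obtain x where x: "norm x = 1" "inner (D x) x < m + \<delta>\<^sup>2 / L" by (auto simp: Q_def)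
    have "inner (C x) x = inner (D x) x - m"
      using x(1) by (simp add: C_def inner_diff_left flip: power2_norm_eq_inner)
    then have "inner (C x) x \<le> \<delta>\<^sup>2 / L" using x(2) by linarith
    then have "inner (C x) x * L \<le> \<delta>\<^sup>2" using L(1) by (simp add: pos_le_divide_eq)
    then have "(norm (C x))\<^sup>2 \<le> \<delta>\<^sup>2" using small[of x] by linarith
    then have "norm (C x) \<le> \<delta>" by (rule power2_le_imp_le) (use d in simp)
    then show "\<exists>x. norm x = 1 \<and> norm (D x - m *\<^sub>R x) \<le> \<delta>" using x(1) by (auto simp: C_def)
  qed
  then show ?thesis using that m0 by blast
qed

text \<open>
  Zero is a point of the spectrum of \<open>B\<close> that is not an eigenvalue, hence it is not isolated. An
  elementary reason is the following. Suppose that \<open>(0, \<epsilon>)\<close> contains no approximate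
  eigenvalue. If \<open>D = B\<^sup>2 - \<epsilon> B\<close> were not positive, it would have a negative approximate eigenvalue
  \<open>m\<close>; but \<open>t\<^sup>2 - \<epsilon> t - m\<close> has both roots in \<open>(0, \<epsilon>)\<close>, so that \<open>D - m\<close> is a product of two
  operators that are bounded below. Thus \<open>\<epsilon> \<langle>B x, x\<rangle> \<le> \<parallel>B x\<parallel>\<^sup>2\<close>. The Cauchy-Schwarz inequality for the
  form of \<open>B\<close> improves this to \<open>\<epsilon> \<parallel>y\<parallel>\<^sup>2 \<le> \<langle>B y, y\<rangle>\<close> for \<open>y\<close> in the range of \<open>B\<close>, which is dense
  because \<open>B\<close> is symmetric and injective. So \<open>0\<close> is not an approximate eigenvalue, a contradiction.
\<close>

lemma approx_eigenvalue_near_bottom: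
  fixes B :: "'a :: {real_inner, banach} \<Rightarrow> 'a"
  assumes bl: "bounded_linear B" and sym: "\<And>x y. inner (B x) y = inner x (B y)"
    and pos: "\<And>x. 0 \<le> inner (B x) x" and inj: "\<And>x. B x = 0 \<Longrightarrow> x = 0"
    and bottom: "approx_eigenvalue B 0" and eps: "\<epsilon> > 0"
  shows "\<exists>\<mu>. 0 < \<mu> \<and> \<mu> < \<epsilon> \<and> approx_eigenvalue B \<mu>"
proof (rule ccontr)
  assume none: "\<not> ?thesis"
  have lin: "linear B" using bl bounded_linear.linear by blast
  define D where "D = (\<lambda>x. B (B x) - \<epsilon> *\<^sub>R B x)"
  have Dbl: "bounded_linear D"
    unfolding D_def
    by (intro bounded_linear_sub bounded_linear_compose[OF bl bl] bounded_linear_scaleR_right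
        bounded_linear_compose[OF bounded_linear_scaleR_right bl])
  have Dsym: "inner (D x) y = inner x (D y)" for x y
    by (simp add: D_def inner_diff_left inner_diff_right sym)
  have Dpos: "0 \<le> inner (D x) x" for x
  proof (rule ccontr)
    assume "\<not> ?thesis"
    then obtain m where m: "m < 0" "approx_eigenvalue D m"
      using form_infimum_approx_eigenvalue[OF Dbl Dsym, of x] by auto
    \<comment> \<open>The roots are real because \<open>D + \<epsilon>\<^sup>2/4 = (B - \<epsilon>/2)\<^sup>2\<close> is positive.\<close>
    have low: "- (\<epsilon>\<^sup>2 / 4) \<le> m"
    proof (rule field_le_epsilon)
      fix \<delta> :: real assume "\<delta> > 0"
      then obtain x where x: "norm x = 1" "norm (D x - m *\<^sub>R x) \<le> \<delta>"
        using m(2) unfolding approx_eigenvalue_def by blast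
      have "inner (D x - m *\<^sub>R x) x \<le> \<delta>"
        using norm_cauchy_schwarz[of "D x - m *\<^sub>R x" x] x by simp
      moreover have "inner (D x - m *\<^sub>R x) x = inner (D x) x - m"
        using x(1) by (simp add: inner_diff_left flip: power2_norm_eq_inner)
      moreover have "inner (D x) x = (norm (B x - (\<epsilon> / 2) *\<^sub>R x))\<^sup>2 - (\<epsilon> / 2)\<^sup>2"
      proof -
        have "(norm (B x - (\<epsilon> / 2) *\<^sub>R x))\<^sup>2 = (norm (B x))\<^sup>2 - \<epsilon> * inner (B x) x + (\<epsilon> / 2)\<^sup>2"
          using dot_norm_neg[of "B x" "(\<epsilon> / 2) *\<^sub>R x"] x(1) eps
          by (simp add: power_mult_distrib)
        moreover have "inner (D x) x = (norm (B x))\<^sup>2 - \<epsilon> * inner (B x) x"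
          by (simp add: D_def inner_diff_left inner_diff_right sym power2_norm_eq_inner inner_commute)
        ultimately show ?thesis by simp
      qed
      moreover have "0 \<le> (norm (B x - (\<epsilon> / 2) *\<^sub>R x))\<^sup>2" by simp
      ultimately have "- (\<epsilon> / 2)\<^sup>2 \<le> m + \<delta>" by linarith
      then show "- (\<epsilon>\<^sup>2 / 4) \<le> m + \<delta>" by (simp add: power_divide)
    qed
    define w where "w = sqrt (\<epsilon>\<^sup>2 / 4 + m)"
    have w: "0 \<le> w" "w\<^sup>2 = \<epsilon>\<^sup>2 / 4 + m" using low by (simp_all add: w_def)
    have "w\<^sup>2 < (\<epsilon> / 2)\<^sup>2" using w(2) m(1) by (simp add: power_divide)
    then have w_lt: "w < \<epsilon> / 2" by (rule power_less_imp_less_base) (use eps in simp)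
    define r1 r2 where "r1 = \<epsilon> / 2 - w" and "r2 = \<epsilon> / 2 + w"
    have r: "0 < r1" "r1 < \<epsilon>" "0 < r2" "r2 < \<epsilon>" using w(1) w_lt eps by (simp_all add: r1_def r2_def)
    have "r1 * r2 = (\<epsilon> / 2)\<^sup>2 - w\<^sup>2"
      by (simp add: r1_def r2_def algebra_simps power2_eq_square)
    then have vieta: "r1 + r2 = \<epsilon>" "r1 * r2 = - m"
      using w(2) by (simp_all add: r1_def r2_def power_divide)
    have "\<exists>k>0. \<forall>x. k * norm x \<le> norm (B x - r1 *\<^sub>R x)"
      using none r not_approx_eigenvalue_bounded_below[OF lin] by blast
    then obtain k1 where k1: "k1 > 0" "\<And>x. k1 * norm x \<le> norm (B x - r1 *\<^sub>R x)"
      by blast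
    have "\<exists>k>0. \<forall>x. k * norm x \<le> norm (B x - r2 *\<^sub>R x)"
      using none r not_approx_eigenvalue_bounded_below[OF lin] by blast
    then obtain k2 where k2: "k2 > 0" "\<And>x. k2 * norm x \<le> norm (B x - r2 *\<^sub>R x)"
      by blast
    have "k1 * k2 / 2 > 0" using k1(1) k2(1) by simp
    then obtain x where x: "norm x = 1" "norm (D x - m *\<^sub>R x) \<le> k1 * k2 / 2"
      using m(2) unfolding approx_eigenvalue_def by blast
    define z where "z = B x - r2 *\<^sub>R x"
    have "B z - r1 *\<^sub>R z = B (B x) - (r1 + r2) *\<^sub>R B x + (r1 * r2) *\<^sub>R x"
      by (simp add: z_def linear_diff[OF lin] linear_scale[OF lin] algebra_simps)
    then have "B z - r1 *\<^sub>R z = D x - m *\<^sub>R x"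
      by (simp add: vieta D_def)
    moreover have "k1 * k2 \<le> k1 * norm z"
      using k2(2)[of x] x(1) k1(1) by (simp add: z_def)
    ultimately have "k1 * k2 \<le> k1 * k2 / 2" using k1(2)[of z] x(2) by simp
    then show False using \<open>k1 * k2 / 2 > 0\<close> by simp
  qed
  have form: "\<epsilon> * inner (B x) x \<le> (norm (B x))\<^sup>2" for x
    using Dpos[of x] by (simp add: D_def inner_diff_left inner_diff_right sym power2_norm_eq_inner inner_commute)
  have range_form: "\<epsilon> * (norm (B x))\<^sup>2 \<le> inner (B (B x)) (B x)" for x
  proof -
    define p where "p = inner (B x) x"
    define q where "q = (norm (B x))\<^sup>2"
    define s where "s = inner (B (B x)) (B x)"
    have nn: "0 \<le> p" "0 \<le> q" "0 \<le> s" using pos by (simp_all add: p_def q_def s_def)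
    have cs: "q\<^sup>2 \<le> p * s"
      using positive_form_Cauchy_Schwarz[OF lin sym pos, of x "B x"]
      by (simp add: p_def q_def s_def power2_norm_eq_inner)
    have "\<epsilon> * p \<le> q" using form[of x] by (simp add: p_def q_def)
    have "q * (\<epsilon> * q) \<le> \<epsilon> * p * s"
      using mult_left_mono[OF cs, of \<epsilon>] eps by (simp add: power2_eq_square algebra_simps)
    also have "\<dots> \<le> q * s" using \<open>\<epsilon> * p \<le> q\<close> nn by (simp add: mult_right_mono)
    finally have "q * (\<epsilon> * q) \<le> q * s" .
    then have "\<epsilon> * q \<le> s"
      using nn by (cases "q = 0") (auto simp: mult_le_cancel_left)
    then show ?thesis by (simp add: q_def s_def)
  qed
  have dense: "closure (range B) = UNIV"
  proof (rule dense_if_trivial_orthogonal_complement)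
    show "subspace (range B)" using lin subspace_UNIV linear_subspace_image by blast
    fix z assume "\<And>v. v \<in> range B \<Longrightarrow> inner z v = 0"
    then have "inner (B z) (B z) = 0" by (simp add: sym)
    then show "z = 0" using inj by simp
  qed
  have form_all: "\<epsilon> * (norm y)\<^sup>2 \<le> inner (B y) y" for y
  proof -
    obtain f where f: "\<And>n. f n \<in> range B" "f \<longlonglongrightarrow> y"
      using dense closure_sequential[of y "range B"] by auto
    have "(\<lambda>n. B (f n)) \<longlonglongrightarrow> B y" using bounded_linear.tendsto[OF bl f(2)] .
    then have "(\<lambda>n. inner (B (f n)) (f n)) \<longlonglongrightarrow> inner (B y) y"
      using f(2) by (rule tendsto_inner)
    moreover have "(\<lambda>n. \<epsilon> * (norm (f n))\<^sup>2) \<longlonglongrightarrow> \<epsilon> * (norm y)\<^sup>2"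
      by (intro tendsto_mult tendsto_const tendsto_power tendsto_norm f(2))
    moreover have "\<epsilon> * (norm (f n))\<^sup>2 \<le> inner (B (f n)) (f n)" for n
      using f(1)[of n] range_form by auto
    ultimately show ?thesis by (intro LIMSEQ_le) auto
  qed
  obtain x where x: "norm x = 1" "norm (B x) \<le> \<epsilon> / 2"
    using bottom half_gt_zero[OF eps] unfolding approx_eigenvalue_def scaleR_zero_left diff_zero
    by blast
  have "\<epsilon> \<le> inner (B x) x" using form_all[of x] x(1) by simp
  also have "\<dots> \<le> \<epsilon> / 2" using norm_cauchy_schwarz[of "B x" x] x by simp
  finally show False using eps by simp
qed

section \<open>Products of two orthogonal projections\<close>

text \<open>
  Norms, powers and kernels only involve the underlying real Hilbert space; the complex structure
  enters later, for the angle, the spectrum and the numerical range.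
\<close>

locale projection_pair =
  fixes P1 P2 :: "'a :: {real_inner, banach} \<Rightarrow> 'a"
  assumes lin1: "linear P1" and lin2: "linear P2"
    and idem1 [simp]: "P1 (P1 x) = P1 x" and idem2 [simp]: "P2 (P2 x) = P2 x"
    and sym1: "inner (P1 x) y = inner x (P1 y)" and sym2: "inner (P2 x) y = inner x (P2 y)"
    and trivial_Int: "P1 x = x \<Longrightarrow> P2 x = x \<Longrightarrow> x = 0"
begin

text \<open>
  The ranges of \<open>P1\<close> and \<open>P2\<close> form a positive angle; \<open>c\<close> bounds its cosine.
\<close>

definition separated :: bool
  where "separated \<longleftrightarrow> (\<exists>c\<ge>0. c < 1 \<and> (\<forall>x. norm (P2 (P1 x)) \<le> c * norm x))"

lemma pythagoras1: "(norm (x - P1 x))\<^sup>2 = (norm x)\<^sup>2 - (norm (P1 x))\<^sup>2"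
  using sym1[of x "P1 x"]
  by (simp add: power2_norm_eq_inner inner_diff_left inner_diff_right inner_commute)

lemma pythagoras2: "(norm (x - P2 x))\<^sup>2 = (norm x)\<^sup>2 - (norm (P2 x))\<^sup>2"
  using sym2[of x "P2 x"]
  by (simp add: power2_norm_eq_inner inner_diff_left inner_diff_right inner_commute)

lemma norm1: "norm (P1 x) \<le> norm x"
proof (rule power2_le_imp_le)
  show "(norm (P1 x))\<^sup>2 \<le> (norm x)\<^sup>2"
    using pythagoras1[of x] zero_le_power2[of "norm (x - P1 x)"] by linarith
qed simp

lemma norm2: "norm (P2 x) \<le> norm x"
proof (rule power2_le_imp_le)
  show "(norm (P2 x))\<^sup>2 \<le> (norm x)\<^sup>2"
    using pythagoras2[of x] zero_le_power2[of "norm (x - P2 x)"] by linarith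
qed simp

lemma bounded_linear1: "bounded_linear P1"
  using lin1 norm1 by (intro bounded_linear_intro[of _ 1]) (auto simp: linear_add linear_scale)

lemma bounded_linear2: "bounded_linear P2"
  using lin2 norm2 by (intro bounded_linear_intro[of _ 1]) (auto simp: linear_add linear_scale)

lemma norm2_eq_imp_fixed: "norm (P2 x) = norm x \<Longrightarrow> P2 x = x"
  using pythagoras2[of x] by simp

lemma swap_fixed_eq_0:
  assumes "P1 (P2 x) = x"
  shows "x = 0"
proof -
  have 1: "P1 x = x" using assms idem1 by metis
  have "norm x \<le> norm (P2 x)" using norm1[of "P2 x"] assms by simp
  then have "P2 x = x" using norm2[of x] by (intro norm2_eq_imp_fixed) simp
  then show ?thesis using 1 trivial_Int by blast
qed

text \<open>
  By Pythagoras, \<open>\<parallel>e - P2 e\<parallel>\<^sup>2 = 1 - \<parallel>P2 e\<parallel>\<^sup>2\<close> for a unit vector \<open>e\<close> fixed by \<open>P1\<close>, and without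
  separation \<open>\<parallel>P2 e\<parallel>\<close> comes arbitrarily close to \<open>1\<close>.
\<close>

lemma near_intersection:
  assumes ns: "\<not> separated" and "\<delta> > 0"
  obtains e where "P1 e = e" "norm e = 1" "norm (e - P2 e) \<le> \<delta>"
proof -
  \<comment> \<open>The minimum keeps the radicand nonnegative when \<open>\<delta> > 1\<close>.\<close>
  define c where "c = sqrt (1 - min 1 (\<delta>\<^sup>2))"
  have d: "0 < min 1 (\<delta>\<^sup>2)" using \<open>\<delta> > 0\<close> by simp
  have c: "0 \<le> c" "c < 1" "c\<^sup>2 = 1 - min 1 (\<delta>\<^sup>2)"
    using d by (simp_all add: c_def)
  then obtain x where x: "c * norm x < norm (P2 (P1 x))"
    using ns unfolding separated_def by (meson not_le)
  have "P1 x \<noteq> 0"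
  proof
    assume "P1 x = 0"
    then show False using x c(1) linear_0[OF lin2] mult_nonneg_nonneg[OF c(1) norm_ge_zero[of x]]
      by simp
  qed
  then have n0: "norm (P1 x) > 0" by simp
  define e where "e = inverse (norm (P1 x)) *\<^sub>R P1 x"
  have e: "P1 e = e" "norm e = 1" using n0 by (simp_all add: e_def linear_scale[OF lin1])
  have "c * norm (P1 x) < norm (P2 (P1 x))"
    using x mult_left_mono[OF norm1[of x] c(1)] by linarith
  then have "c \<le> norm (P2 e)"
    using n0 by (simp add: e_def linear_scale[OF lin2] field_simps)
  then have "c\<^sup>2 \<le> (norm (P2 e))\<^sup>2" using c(1) by (simp add: power_mono)
  then have "(norm (e - P2 e))\<^sup>2 \<le> \<delta>\<^sup>2" using pythagoras2[of e] e(2) c(3) by simp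
  then have "norm (e - P2 e) \<le> \<delta>" by (rule power2_le_imp_le) (use \<open>\<delta> > 0\<close> in simp)
  then show ?thesis using that e by blast
qed

subsection \<open>The norm of the product\<close>

definition T :: "'a \<Rightarrow> 'a"
  where "T = P2 \<circ> P1"

lemma T_apply: "T x = P2 (P1 x)"
  by (simp add: T_def)

lemma bounded_linear_product: "bounded_linear T"
  using bounded_linear_compose[OF bounded_linear2 bounded_linear1] by (simp add: T_def o_def)

lemma linear_product: "linear T"
  using bounded_linear_product by (rule bounded_linear.linear)

lemma norm_product: "norm (T x) \<le> norm x"
  unfolding T_apply
  using norm1[of x] norm2[of "P1 x"] by linarith

lemma onorm_product_eq_1_iff: "onorm T = 1 \<longleftrightarrow> \<not> separated"
proof
  assume 1: "onorm T = 1"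
  show "\<not> separated"
  proof
    assume separated
    then obtain c where "0 \<le> c" "c < 1" "\<And>x. norm (P2 (P1 x)) \<le> c * norm x"
      unfolding separated_def by blast
    then have "onorm T \<le> c" by (intro onorm_bound) (auto simp: T_apply)
    then show False using 1 \<open>c < 1\<close> by simp
  qed
next
  assume ns: "\<not> separated"
  have "onorm T \<le> 1" using norm_product by (intro onorm_bound) auto
  moreover have "\<not> onorm T < 1"
  proof
    assume "onorm T < 1"
    then show False
      using ns onorm[OF bounded_linear_product] onorm_pos_le[OF bounded_linear_product]
      unfolding separated_def by (metis T_apply)
  qed
  ultimately show "onorm T = 1" by simp
qed

subsection \<open>Powers of the product\<close>

lemma funpow_product_linear: "linear (T ^^ n)"
proof (induction n)
  case (Suc n)
  then show ?case
    using linear_compose[OF Suc linear_product] by (simp add: o_def)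
qed (simp add: linear_iff)

lemma norm_funpow_product_antimono:
  assumes "m \<le> n"
  shows "norm ((T ^^ n) x) \<le> norm ((T ^^ m) x)"
  using assms
proof (induction n rule: dec_induct)
  case (step n)
  then show ?case using norm_product[of "(T ^^ n) x"] by simp
qed simp

lemma norm_funpow_product: "norm ((T ^^ n) x) \<le> norm x"
  using norm_funpow_product_antimono[of 0 n x] by simp

text \<open>
  A step of \<open>T\<close> moves \<open>y\<close> by little if it decreases the norm by little: by Pythagoras for both
  projections, \<open>\<parallel>y - T y\<parallel>\<^sup>2 \<le> 2 (\<parallel>y\<parallel>\<^sup>2 - \<parallel>T y\<parallel>\<^sup>2)\<close>. The norms along an orbit converge, so
  \<open>T^n (y - T y)\<close> tends to \<open>0\<close>. The vectors \<open>y - T y\<close> are dense, since a vector orthogonal to all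
  of them is fixed by the adjoint \<open>P1 P2\<close>. Contractivity extends the convergence to the closure.
\<close>

lemma funpow_product_tendsto_0: "(\<lambda>n. (T ^^ n) x) \<longlonglongrightarrow> 0"
proof -
  have step: "(norm (y - T y))\<^sup>2 \<le> 2 * ((norm y)\<^sup>2 - (norm (T y))\<^sup>2)" for y
  proof -
    define a b where "a = norm (y - P1 y)" and "b = norm (P1 y - P2 (P1 y))"
    have "y - T y = (y - P1 y) + (P1 y - P2 (P1 y))" by (simp add: T_apply)
    then have "norm (y - T y) \<le> a + b" unfolding a_def b_def by (metis norm_triangle_ineq)
    then have "(norm (y - T y))\<^sup>2 \<le> (a + b)\<^sup>2" by (simp add: power_mono)
    also have "\<dots> \<le> 2 * (a\<^sup>2 + b\<^sup>2)" using sum_squares_bound[of a b] by (simp add: power2_sum)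
    also have "a\<^sup>2 + b\<^sup>2 = (norm y)\<^sup>2 - (norm (T y))\<^sup>2"
      using pythagoras1[of y] pythagoras2[of "P1 y"] by (simp add: a_def b_def T_apply)
    finally show ?thesis .
  qed
  have range: "(\<lambda>n. (T ^^ n) (y - T y)) \<longlonglongrightarrow> 0" for y
  proof -
    define f where "f = (\<lambda>n. (norm ((T ^^ n) y))\<^sup>2)"
    have "decseq f"
      unfolding f_def
      by (intro decseq_SucI power_mono norm_funpow_product_antimono) auto
    then obtain l where l: "f \<longlonglongrightarrow> l"
      using decseq_convergent[of f 0] by (auto simp: f_def)
    have "(\<lambda>n. 2 * (f n - f (Suc n))) \<longlonglongrightarrow> 2 * (l - l)"
      by (intro tendsto_intros l LIMSEQ_Suc)
    then have lim: "(\<lambda>n. 2 * (f n - f (Suc n))) \<longlonglongrightarrow> 0" by simp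
    have "(norm ((T ^^ n) (y - T y)))\<^sup>2 \<le> 2 * (f n - f (Suc n))" for n
    proof -
      have "(T ^^ n) (y - T y) = (T ^^ n) y - T ((T ^^ n) y)"
        by (simp add: linear_diff[OF funpow_product_linear] funpow_swap1)
      then show ?thesis using step[of "(T ^^ n) y"] by (simp add: f_def)
    qed
    then have "(\<lambda>n. (norm ((T ^^ n) (y - T y)))\<^sup>2) \<longlonglongrightarrow> 0"
      by (intro tendsto_sandwich[OF _ _ tendsto_const lim]) auto
    then show ?thesis by (simp add: tendsto_norm_zero_iff power_tendsto_0_iff)
  qed
  have dense: "closure (range (\<lambda>y. y - T y)) = UNIV"
  proof (rule dense_if_trivial_orthogonal_complement)
    have "linear (\<lambda>y. y - T y)" by (intro linear_compose_sub linear_ident linear_product)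
    then show "subspace (range (\<lambda>y. y - T y))" using subspace_UNIV linear_subspace_image by blast
    fix z assume z: "\<And>v. v \<in> range (\<lambda>y. y - T y) \<Longrightarrow> inner z v = 0"
    have "inner (z - P1 (P2 z)) y = inner z (y - T y)" for y
      by (simp add: T_apply inner_diff_left inner_diff_right sym1 sym2)
    then have "inner (z - P1 (P2 z)) (z - P1 (P2 z)) = 0" using z by auto
    then show "z = 0" using swap_fixed_eq_0[of z] by simp
  qed
  have "(\<lambda>n. (T ^^ n) x) \<longlonglongrightarrow> 0"
  proof (rule LIMSEQ_I)
    fix r :: real assume "0 < r"
    then obtain y where y: "dist (y - T y) x < r / 2"
      using dense closure_approachable[of x "range (\<lambda>y. y - T y)"] half_gt_zero by blast
    obtain N where N: "\<And>n. n \<ge> N \<Longrightarrow> norm ((T ^^ n) (y - T y)) < r / 2"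
      using LIMSEQ_D[OF range[of y], of "r / 2"] \<open>0 < r\<close> by auto
    have "norm ((T ^^ n) x - 0) < r" if "n \<ge> N" for n
    proof -
      have "(T ^^ n) x = (T ^^ n) (x - (y - T y)) + (T ^^ n) (y - T y)"
        by (simp add: linear_diff[OF funpow_product_linear])
      then have "norm ((T ^^ n) x) \<le> norm ((T ^^ n) (x - (y - T y))) + norm ((T ^^ n) (y - T y))"
        by (metis norm_triangle_ineq)
      also have "\<dots> \<le> norm (x - (y - T y)) + norm ((T ^^ n) (y - T y))"
        using norm_funpow_product by simp
      also have "\<dots> < r" using y N[OF that] by (simp add: dist_norm norm_minus_commute)
      finally show ?thesis by simp
    qed
    then show "\<exists>N. \<forall>n\<ge>N. norm ((T ^^ n) x - 0) < r" by blast
  qed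
  then show ?thesis by (simp add: T_apply)
qed

text \<open>
  If \<open>\<parallel>T e - e\<parallel> \<le> \<delta>\<close> then \<open>\<parallel>T^n e - e\<parallel> \<le> n \<delta>\<close>, because \<open>T\<close> is a contraction.
\<close>

lemma funpow_product_almost_isometric:
  assumes ns: "\<not> separated"
  shows "\<exists>e. norm e \<le> 1 \<and> 3/4 \<le> norm ((T ^^ n) e)"
proof -
  define \<delta> :: real where "\<delta> = 1 / (4 * (real n + 1))"
  have "\<delta> > 0" by (simp add: \<delta>_def)
  then obtain e where e: "P1 e = e" "norm e = 1" "norm (e - P2 e) \<le> \<delta>"
    using near_intersection[OF ns] by blast
  have "norm ((T ^^ k) e - e) \<le> real k * \<delta>" for k
  proof (induction k)
    case (Suc k)
    have "(T ^^ Suc k) e - e = T ((T ^^ k) e - e) + (T e - e)"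
      by (simp add: linear_diff[OF linear_product])
    then have "norm ((T ^^ Suc k) e - e) \<le> norm (T ((T ^^ k) e - e)) + norm (T e - e)"
      by (metis norm_triangle_ineq)
    also have "\<dots> \<le> real k * \<delta> + \<delta>"
    proof (rule add_mono)
      show "norm (T ((T ^^ k) e - e)) \<le> real k * \<delta>"
        using Suc norm_product[of "(T ^^ k) e - e"] by (rule order_trans[rotated])
      show "norm (T e - e) \<le> \<delta>" using e by (simp add: T_apply norm_minus_commute)
    qed
    finally show ?case by (simp add: algebra_simps)
  qed simp
  moreover have "real n * \<delta> \<le> 1/4" by (simp add: \<delta>_def field_simps)
  ultimately have "norm ((T ^^ n) e - e) \<le> 1/4" by (meson order_trans)
  then have "3/4 \<le> norm ((T ^^ n) e)"
    using norm_triangle_ineq2[of e "(T ^^ n) e"] e(2) by (simp add: norm_minus_commute)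
  then show ?thesis using e(2) by (intro exI[of _ e]) simp
qed

text \<open>
  Choose \<open>N k\<close> beyond which \<open>a\<close> is at most \<open>M 3^-k / 4\<close>. As \<open>\<parallel>T^n x\<parallel>\<close> decreases in \<open>n\<close>, on the block
  from \<open>N k\<close> to \<open>N (k + 1)\<close> it suffices to bound it from below at the right end, and the gliding hump
  argument for the operators \<open>T^N (k + 1)\<close> does this for all blocks simultaneously.
\<close>

lemma slow_orbit:
  assumes ns: "\<not> separated" and a: "a \<longlonglongrightarrow> 0"
  shows "\<exists>x. \<forall>n. a n \<le> norm ((T ^^ n) x)"
proof -
  have "Bseq a" using a convergentI convergent_imp_Bseq by blast
  then obtain K where K: "K > 0" "\<And>n. norm (a n) \<le> K" using BseqE by blast
  define M where "M = 4 * K"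
  have M: "M > 0" "\<And>n. a n \<le> M / 4" using K by (auto simp: M_def abs_le_iff)
  have "\<exists>N. \<forall>n\<ge>N. a n \<le> M * (1/3) ^ k / 4" for k
  proof -
    have "0 < M * (1/3) ^ k / 4" using M by simp
    then show ?thesis using LIMSEQ_D[OF a] by (metis abs_le_D1 diff_zero less_imp_le real_norm_def)
  qed
  then obtain N0 where N0: "\<And>k n. n \<ge> N0 k \<Longrightarrow> a n \<le> M * (1/3) ^ k / 4" by metis
  \<comment> \<open>The summand \<open>k\<close> makes \<open>N\<close> unbounded, so that the blocks cover all \<open>n\<close>.\<close>
  define N where "N = (\<lambda>k. N0 k + k)"
  have N: "a n \<le> M * (1/3) ^ k / 4" if "n \<ge> N k" for k n
    using that N0 by (simp add: N_def)
  have "\<exists>x. \<forall>k. (1/3) ^ k / 4 \<le> norm ((T ^^ N (Suc k)) x)"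
    by (rule gliding_hump[OF funpow_product_linear norm_funpow_product
          funpow_product_almost_isometric[OF ns]])
  then obtain x where x: "\<And>k. (1/3) ^ k / 4 \<le> norm ((T ^^ N (Suc k)) x)" by blast
  have "a n \<le> norm ((T ^^ n) (M *\<^sub>R x))" for n
  proof -
    define k where "k = (LEAST k. n < N (Suc k))"
    have "n < N (Suc n)" by (simp add: N_def)
    then have k: "n < N (Suc k)" unfolding k_def by (rule LeastI)
    have "a n \<le> M * ((1/3) ^ k / 4)"
    proof (cases k)
      case 0
      then show ?thesis using M by simp
    next
      case (Suc j)
      then have "\<not> n < N (Suc j)" using not_less_Least[of j "\<lambda>k. n < N (Suc k)"] by (simp add: k_def)
      then show ?thesis using N[of k n] Suc by simp
    qed
    also have "\<dots> \<le> M * norm ((T ^^ N (Suc k)) x)" using x[of k] M by (intro mult_left_mono) auto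
    also have "\<dots> \<le> M * norm ((T ^^ n) x)"
      using M k norm_funpow_product_antimono[of n "N (Suc k)" x]
      by (intro mult_left_mono) auto
    also have "\<dots> = norm ((T ^^ n) (M *\<^sub>R x))"
      using M funpow_product_linear[of n] by (simp add: linear_scale)
    finally show ?thesis .
  qed
  then show ?thesis by auto
qed

text \<open>
  The norms along any orbit are \<open>O(d^n)\<close> for some \<open>d < 1\<close>, so they eventually drop below the null
  sequence \<open>n d^n\<close>.
\<close>

lemma no_slow_orbit:
  assumes separated
  shows "\<exists>a. (\<forall>n. 0 \<le> a n) \<and> a \<longlonglongrightarrow> (0 :: real) \<and> (\<forall>x. \<exists>n\<ge>1. norm ((T ^^ n) x) < a n)"
proof -
  obtain c where c: "0 \<le> c" "c < 1" "\<And>x. norm (P2 (P1 x)) \<le> c * norm x"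
    using assms unfolding separated_def by blast
  \<comment> \<open>\<open>d\<close> replaces \<open>c\<close> to be positive when \<open>c = 0\<close>.\<close>
  define d where "d = max c (1/2)"
  have d: "0 < d" "d < 1" "c \<le> d" using c by (auto simp: d_def)
  have bound: "norm ((T ^^ n) x) \<le> d ^ n * norm x" for n x
  proof (induction n)
    case (Suc n)
    have "norm ((T ^^ Suc n) x) \<le> c * norm ((T ^^ n) x)"
      using c(3) by (simp add: T_apply)
    also have "\<dots> \<le> d * (d ^ n * norm x)"
      using Suc d c(1) by (intro mult_mono) auto
    finally show ?case by (simp add: mult.assoc)
  qed simp
  have "(\<lambda>n. real n * d ^ n) \<longlonglongrightarrow> 0" using d by (intro powser_times_n_limit_0) simp
  moreover have "\<exists>n\<ge>1. norm ((T ^^ n) x) < real n * d ^ n" for x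
  proof -
    obtain n where n: "norm x < real n" using reals_Archimedean2 by blast
    have "norm ((T ^^ n) x) \<le> d ^ n * norm x" by (rule bound)
    also have "\<dots> < d ^ n * real n" using n d by simp
    finally show ?thesis using n by (intro exI[of _ n]) (auto simp: mult.commute Suc_le_eq intro: ccontr)
  qed
  ultimately show ?thesis using d by (intro exI[of _ "\<lambda>n. real n * d ^ n"]) auto
qed

subsection \<open>The sum of the orthogonal complements\<close>

text \<open>
  The solution is a fixed point of the contraction \<open>h \<mapsto> z + P2 P1 h\<close>.
\<close>

lemma separated_surj:
  assumes separated
  shows "\<exists>h. h - P2 (P1 h) = z"
proof -
  obtain c where c: "0 \<le> c" "c < 1" "\<And>x. norm (P2 (P1 x)) \<le> c * norm x"
    using assms unfolding separated_def by blast
  have "dist (z + P2 (P1 x)) (z + P2 (P1 y)) \<le> c * dist x y" for x y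
    using c(3)[of "x - y"] by (simp add: dist_norm linear_diff[OF lin1] linear_diff[OF lin2])
  then have "\<exists>!h. z + P2 (P1 h) = h" using c by (intro banach_fix_type[of c]) auto
  then obtain h where "z + P2 (P1 h) = h" by blast
  then show ?thesis by (metis add_diff_cancel_right')
qed

text \<open>
  If the pair is separated, \<open>z = h - P2 P1 h = (h - P1 h) + (P1 h - P2 P1 h)\<close> splits any \<open>z\<close>. Conversely,
  the sum is always dense, as a vector orthogonal to both kernels is fixed by both projections; so if
  the sum is closed, every \<open>z\<close> splits as \<open>x + y\<close>. For \<open>e\<^sub>k\<close> fixed by \<open>P1\<close> with
  \<open>\<parallel>e\<^sub>k - P2 e\<^sub>k\<parallel> \<le> 4^-k\<close> this gives \<open>\<bar>\<langle>e\<^sub>k, z\<rangle>\<bar> = \<bar>\<langle>e\<^sub>k - P2 e\<^sub>k, y\<rangle>\<bar> \<le> 4^-k \<parallel>y\<parallel>\<close>, whereas the gliding hump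
  argument provides a \<open>z\<close> for which the left-hand side is at least \<open>3^-k / 4\<close>.
\<close>

lemma closed_sum_kernels_iff:
  "closed {x + y |x y. P1 x = 0 \<and> P2 y = 0} \<longleftrightarrow> separated"  (is "closed ?V \<longleftrightarrow> _")
proof
  assume separated
  have "z \<in> ?V" for z
  proof -
    obtain h where "h - P2 (P1 h) = z" using separated_surj[OF \<open>separated\<close>] by blast
    then have "z = (h - P1 h) + (P1 h - P2 (P1 h))" by simp
    moreover have "P1 (h - P1 h) = 0" "P2 (P1 h - P2 (P1 h)) = 0"
      by (simp_all add: linear_diff[OF lin1] linear_diff[OF lin2])
    ultimately show ?thesis by blast
  qed
  then have "?V = UNIV" by blast
  then show "closed ?V" by simp
next
  assume closed: "closed ?V"
  have sub: "subspace ?V"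
  proof (rule subspaceI)
    show "0 \<in> ?V" using linear_0[OF lin1] linear_0[OF lin2] by force
  next
    fix u v assume "u \<in> ?V" "v \<in> ?V"
    then obtain a b c d where "u = a + b" "v = c + d" "P1 a = 0" "P2 b = 0" "P1 c = 0" "P2 d = 0"
      by blast
    then have "u + v = (a + c) + (b + d)" "P1 (a + c) = 0" "P2 (b + d) = 0"
      by (simp_all add: linear_add[OF lin1] linear_add[OF lin2])
    then show "u + v \<in> ?V" by blast
  next
    fix r u assume "u \<in> ?V"
    then obtain a b where "u = a + b" "P1 a = 0" "P2 b = 0" by blast
    then have "r *\<^sub>R u = r *\<^sub>R a + r *\<^sub>R b" "P1 (r *\<^sub>R a) = 0" "P2 (r *\<^sub>R b) = 0"
      by (simp_all add: linear_scale[OF lin1] linear_scale[OF lin2] scaleR_add_right)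
    then show "r *\<^sub>R u \<in> ?V" by blast
  qed
  have "closure ?V = UNIV"
  proof (rule dense_if_trivial_orthogonal_complement[OF sub])
    fix z assume z: "\<And>v. v \<in> ?V \<Longrightarrow> inner z v = 0"
    have "P1 (z - P1 z) = 0" "P2 (z - P2 z) = 0"
      by (simp_all add: linear_diff[OF lin1] linear_diff[OF lin2])
    then have "(z - P1 z) + 0 \<in> ?V" "0 + (z - P2 z) \<in> ?V"
      using linear_0[OF lin1] linear_0[OF lin2] by blast+
    then have "inner z (z - P1 z) = 0" "inner z (z - P2 z) = 0" using z by force+
    then have "(norm (z - P1 z))\<^sup>2 = 0" "(norm (z - P2 z))\<^sup>2 = 0"
      using sym1[of z "P1 z"] sym2[of z "P2 z"]
      by (simp_all add: pythagoras1 pythagoras2 power2_norm_eq_inner inner_diff_right inner_commute)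
    then show "z = 0" using trivial_Int by simp
  qed
  then have all: "?V = UNIV" using closed by simp
  show separated
  proof (rule ccontr)
    assume ns: "\<not> separated"
    have "\<exists>e. P1 e = e \<and> norm e = 1 \<and> norm (e - P2 e) \<le> (1/4) ^ k" for k :: nat
      using near_intersection[OF ns, of "(1/4) ^ k"] by auto
    then obtain e where e: "\<And>k. P1 (e k) = e k" "\<And>k. norm (e k) = 1"
      "\<And>k. norm (e k - P2 (e k)) \<le> (1/4) ^ k" by metis
    have "\<exists>z. \<forall>k. (1/3) ^ k / 4 \<le> norm (inner (e k) z)"
    proof (rule gliding_hump)
      show "linear (inner (e k))" for k by (simp add: linear_iff inner_add_right)
      show "norm (inner (e k) z) \<le> norm z" for k z
        using Cauchy_Schwarz_ineq2[of "e k" z] e(2) by simp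
      show "\<exists>x. norm x \<le> 1 \<and> 3/4 \<le> norm (inner (e k) x)" for k
        using e(2)[of k] by (intro exI[of _ "e k"]) (simp flip: power2_norm_eq_inner)
    qed
    then obtain z where z: "\<And>k. (1/3) ^ k / 4 \<le> \<bar>inner (e k) z\<bar>" by auto
    have "z \<in> ?V" using all by simp
    then obtain x y where xy: "z = x + y" "P1 x = 0" "P2 y = 0" by blast
    have "(4/3) ^ k \<le> 4 * norm y" for k
    proof -
      have "inner (e k) x = 0" using sym1[of "e k" x] e(1)[of k] xy(2) by simp
      moreover have "inner (P2 (e k)) y = 0" using sym2[of "e k" y] xy(3) by simp
      ultimately have "inner (e k) z = inner (e k - P2 (e k)) y"
        by (simp add: xy(1) inner_add_right inner_diff_left)
      then have "\<bar>inner (e k) z\<bar> \<le> norm (e k - P2 (e k)) * norm y"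
        using Cauchy_Schwarz_ineq2 by metis
      also have "\<dots> \<le> (1/4) ^ k * norm y" using e(3) by (simp add: mult_right_mono)
      finally have "(1/3) ^ k / 4 \<le> (1/4) ^ k * norm y" using z[of k] by linarith
      then have "4 ^ k * ((1/3) ^ k / 4) \<le> 4 ^ k * ((1/4) ^ k * norm y)" by (intro mult_left_mono) auto
      then show ?thesis by (simp add: power_divide)
    qed
    moreover obtain k where "4 * norm y < (4/3) ^ k" using real_arch_pow[of "4/3"] by auto
    ultimately show False using not_le by blast
  qed
qed

subsection \<open>Approximate eigenvalues accumulating at one\<close>

text \<open>
  This applies the non-isolation of the bottom of the spectrum to \<open>B = 1 - P1 P2 P1\<close>.
\<close>

lemma approx_eigenvalue_compression:
  assumes ns: "\<not> separated" and "\<epsilon> > 0"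
  shows "\<exists>l. 1 - \<epsilon> < l \<and> l < 1 \<and> approx_eigenvalue (\<lambda>x. P1 (P2 (P1 x))) l"
proof -
  define B where "B = (\<lambda>x. x - P1 (P2 (P1 x)))"
  have "\<exists>\<mu>. 0 < \<mu> \<and> \<mu> < \<epsilon> \<and> approx_eigenvalue B \<mu>"
  proof (rule approx_eigenvalue_near_bottom[OF _ _ _ _ _ \<open>\<epsilon> > 0\<close>])
    show "bounded_linear B"
      unfolding B_def
      by (intro bounded_linear_sub bounded_linear_ident bounded_linear_compose[OF bounded_linear1]
          bounded_linear_compose[OF bounded_linear2] bounded_linear1)
    show "inner (B x) y = inner x (B y)" for x y
      by (simp add: B_def inner_diff_left inner_diff_right sym1 sym2)
    show "0 \<le> inner (B x) x" for x
    proof -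
      have "inner (P1 (P2 (P1 x))) x = (norm (P2 (P1 x)))\<^sup>2"
        using sym1[of "P2 (P1 x)" x] sym2[of "P2 (P1 x)" "P1 x"]
        by (simp add: power2_norm_eq_inner)
      moreover have "(norm (P2 (P1 x)))\<^sup>2 \<le> (norm x)\<^sup>2"
        using norm_product[of x] by (simp add: T_apply power_mono)
      ultimately show ?thesis by (simp add: B_def inner_diff_left power2_norm_eq_inner)
    qed
    show "x = 0" if "B x = 0" for x
    proof (rule swap_fixed_eq_0)
      have "P1 (P2 (P1 x)) = x" using that by (simp add: B_def)
      then show "P1 (P2 x) = x" using idem1 by metis
    qed
    show "approx_eigenvalue B 0"
      unfolding approx_eigenvalue_def
    proof (intro allI impI)
      fix \<delta> :: real assume "\<delta> > 0"
      then obtain e where e: "P1 e = e" "norm e = 1" "norm (e - P2 e) \<le> \<delta>"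
        using near_intersection[OF ns] by blast
      have "B e = P1 (e - P2 e)" by (simp add: B_def e(1) linear_diff[OF lin1])
      then have "norm (B e) \<le> \<delta>" using norm1[of "e - P2 e"] e(3) by simp
      then show "\<exists>x. norm x = 1 \<and> norm (B x - 0 *\<^sub>R x) \<le> \<delta>" using e(2) by auto
    qed
  qed
  then obtain \<mu> where \<mu>: "0 < \<mu>" "\<mu> < \<epsilon>" "approx_eigenvalue B \<mu>" by blast
  have "norm (P1 (P2 (P1 x)) - (1 - \<mu>) *\<^sub>R x) = norm (B x - \<mu> *\<^sub>R x)" for x
  proof -
    have "P1 (P2 (P1 x)) - (1 - \<mu>) *\<^sub>R x = - (B x - \<mu> *\<^sub>R x)"
      by (simp add: B_def scaleR_diff_left)
    then show ?thesis by (metis norm_minus_cancel)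
  qed
  then have "approx_eigenvalue (\<lambda>x. P1 (P2 (P1 x))) (1 - \<mu>)"
    using \<mu>(3) by (simp add: approx_eigenvalue_def)
  then show ?thesis using \<mu> by (intro exI[of _ "1 - \<mu>"]) auto
qed

text \<open>
  The three limits determine the numerical range of \<open>P2 P1\<close> on the
  span of \<open>P1 e\<close> and \<open>P2 P1 e\<close>. With \<open>A = P1 P2 P1\<close> they are read off from \<open>\<langle>A e, P1 e\<rangle> = \<langle>A e, e\<rangle>\<close>,
  which equals \<open>\<parallel>P2 P1 e\<parallel>\<^sup>2\<close>, and from \<open>\<parallel>A e\<parallel>\<close>; the case \<open>l = 0\<close> must be excluded because then
  \<open>P1 e\<close> may vanish.
\<close>

lemma approx_eigenvectors_compression:
  assumes ev: "approx_eigenvalue (\<lambda>x. P1 (P2 (P1 x))) l" and l: "l > 0"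
  obtains e where "(\<lambda>n. (norm (P1 (e n)))\<^sup>2) \<longlonglongrightarrow> 1"
    "(\<lambda>n. (norm (P2 (P1 (e n))))\<^sup>2) \<longlonglongrightarrow> l"
    "(\<lambda>n. (norm (P1 (P2 (P1 (e n)))))\<^sup>2) \<longlonglongrightarrow> l\<^sup>2"
proof -
  define A where "A = (\<lambda>x. P1 (P2 (P1 x)))"
  have "\<exists>x. norm x = 1 \<and> norm (A x - l *\<^sub>R x) \<le> inverse (real (Suc n))" for n
    using ev unfolding approx_eigenvalue_def A_def by auto
  then obtain e where e: "\<And>n. norm (e n) = 1"
    "\<And>n. norm (A (e n) - l *\<^sub>R e n) \<le> inverse (real (Suc n))" by metis
  have lim: "(\<lambda>n. A (e n) - l *\<^sub>R e n) \<longlonglongrightarrow> 0"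
    by (rule Lim_null_comparison[OF _ LIMSEQ_inverse_real_of_nat]) (intro always_eventually allI e(2))
  have small: "(\<lambda>n. inner (A (e n) - l *\<^sub>R e n) (y n)) \<longlonglongrightarrow> 0" if "\<And>n. norm (y n) \<le> 1" for y
  proof (rule Lim_null_comparison[OF _ tendsto_norm_zero[OF lim]])
    have "norm (inner (A (e n) - l *\<^sub>R e n) (y n)) \<le> norm (A (e n) - l *\<^sub>R e n)" for n
      using Cauchy_Schwarz_ineq2[of "A (e n) - l *\<^sub>R e n" "y n"]
        mult_left_mono[OF that[of n], of "norm (A (e n) - l *\<^sub>R e n)"] by simp
    then show "\<forall>\<^sub>F n in sequentially. norm (inner (A (e n) - l *\<^sub>R e n) (y n))
        \<le> norm (A (e n) - l *\<^sub>R e n)" by simp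
  qed
  have A_form: "inner (A x) x = (norm (P2 (P1 x)))\<^sup>2" "inner (A x) (P1 x) = (norm (P2 (P1 x)))\<^sup>2" for x
    using sym1[of "P2 (P1 x)" x] sym1[of "P2 (P1 x)" "P1 x"] sym2[of "P2 (P1 x)" "P1 x"]
    by (simp_all add: A_def power2_norm_eq_inner)
  have "(\<lambda>n. inner (A (e n) - l *\<^sub>R e n) (e n) + l) \<longlonglongrightarrow> 0 + l"
    by (intro tendsto_add tendsto_const small) (simp add: e(1))
  then have b: "(\<lambda>n. (norm (P2 (P1 (e n))))\<^sup>2) \<longlonglongrightarrow> l"
    by (simp add: inner_diff_left A_form e(1) flip: power2_norm_eq_inner)
  have P1_form: "inner x (P1 x) = (norm (P1 x))\<^sup>2" for x
    using sym1[of x "P1 x"] by (simp add: power2_norm_eq_inner inner_commute)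
  have "(\<lambda>n. ((norm (P2 (P1 (e n))))\<^sup>2 - inner (A (e n) - l *\<^sub>R e n) (P1 (e n))) / l) \<longlonglongrightarrow> (l - 0) / l"
    using norm1 e(1) l by (intro tendsto_intros b small) (metis, simp)
  then have a: "(\<lambda>n. (norm (P1 (e n)))\<^sup>2) \<longlonglongrightarrow> 1"
    using l by (simp add: inner_diff_left A_form P1_form)
  have "(\<lambda>n. norm (A (e n))) \<longlonglongrightarrow> l"
  proof (rule Lim_transform[of "\<lambda>_. l"])
    show "(\<lambda>n. norm (A (e n)) - l) \<longlonglongrightarrow> 0"
    proof (rule Lim_null_comparison[OF _ tendsto_norm_zero[OF lim]])
      have "norm (norm (A (e n)) - l) \<le> norm (A (e n) - l *\<^sub>R e n)" for n
        using norm_triangle_ineq3[of "A (e n)" "l *\<^sub>R e n"] e(1)[of n] l by simp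
      then show "\<forall>\<^sub>F n in sequentially. norm (norm (A (e n)) - l) \<le> norm (A (e n) - l *\<^sub>R e n)"
        by simp
    qed
  qed simp
  then have "(\<lambda>n. (norm (A (e n)))\<^sup>2) \<longlonglongrightarrow> l\<^sup>2" by (intro tendsto_intros)
  then show ?thesis using that a b by (simp add: A_def)
qed

end

section \<open>The complex inner product and complex orthogonal projections\<close>

lemma cinner_add_right: "cinner x (y + z) = cinner x y + cinner x (z :: 'a :: chilbert_space)"
  by (metis cinner_add_left cinner_commute complex_cnj_add)

lemma cinner_scaleC_right: "cinner x (c *\<^sub>C y) = cnj c * cinner x (y :: 'a :: chilbert_space)"
  by (metis cinner_scaleC_left cinner_commute complex_cnj_mult)

lemma scaleC_one [simp]: "1 *\<^sub>C x = (x :: 'a :: chilbert_space)"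
  using scaleC_of_real[of 1 x] by simp

lemma scaleC_minus: "(- c) *\<^sub>C x = - (c *\<^sub>C (x :: 'a :: chilbert_space))"
proof -
  have "(- c) *\<^sub>C x = (-1) *\<^sub>C (c *\<^sub>C x)" by (simp add: scaleC_scaleC)
  also have "\<dots> = - (c *\<^sub>C x)" using scaleC_of_real[of "-1" "c *\<^sub>C x"] by simp
  finally show ?thesis .
qed

lemma scaleC_diff_left: "(c - d) *\<^sub>C x = c *\<^sub>C x - d *\<^sub>C (x :: 'a :: chilbert_space)"
  using scaleC_add_left[of c "- d" x] by (simp add: scaleC_minus)

lemma scaleC_minus_right: "c *\<^sub>C (- x) = - (c *\<^sub>C (x :: 'a :: chilbert_space))"
  using scaleC_scaleC[of c "-1" x] scaleC_scaleC[of "-1" c x] scaleC_minus[of 1 x]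
    scaleC_minus[of 1 "c *\<^sub>C x"] by simp

lemma scaleC_diff_right: "c *\<^sub>C (x - y) = c *\<^sub>C x - c *\<^sub>C (y :: 'a :: chilbert_space)"
  using scaleC_add_right[of c x "- y"] by (simp add: scaleC_minus_right)

lemma cinner_minus_left: "cinner (- x) y = - cinner x (y :: 'a :: chilbert_space)"
  using cinner_scaleC_left[of "-1" x y] by (simp add: scaleC_minus)

lemma cinner_diff_left: "cinner (x - y) z = cinner x z - cinner y (z :: 'a :: chilbert_space)"
  using cinner_add_left[of x "- y" z] by (simp add: cinner_minus_left)

lemma cinner_diff_right: "cinner x (y - z) = cinner x y - cinner x (z :: 'a :: chilbert_space)"
  by (metis cinner_diff_left cinner_commute complex_cnj_diff)

lemma norm_scaleC: "norm (c *\<^sub>C x) = cmod c * norm (x :: 'a :: chilbert_space)"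
proof -
  have "complex_of_real ((norm (c *\<^sub>C x))\<^sup>2) = cnj c * (c * complex_of_real ((norm x)\<^sup>2))"
    by (simp only: cinner_self[symmetric] cinner_scaleC_left cinner_scaleC_right)
  also have "\<dots> = complex_of_real ((cmod c * norm x)\<^sup>2)"
    by (simp add: power_mult_distrib complex_norm_square mult.commute del: of_real_power)
  finally have "(norm (c *\<^sub>C x))\<^sup>2 = (cmod c * norm x)\<^sup>2" by (simp only: of_real_eq_iff)
  then show ?thesis by (simp add: power2_eq_iff_nonneg)
qed

text \<open>
  Rotating \<open>x\<close> by a phase makes the complex inner product real and nonnegative, which reduces the
  inequality to the real one.
\<close>

lemma cmod_cinner_le: "cmod (cinner x y) \<le> norm x * norm (y :: 'a :: chilbert_space)"
proof (cases "cinner x y = 0")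
  case False
  define c where "c = cnj (sgn (cinner x y))"
  have c: "cmod c = 1" using False by (simp add: c_def norm_sgn)
  have "cinner (c *\<^sub>C x) y = cinner x y * cnj (cinner x y) / cmod (cinner x y)"
    by (simp add: c_def cinner_scaleC_left sgn_eq mult.commute)
  also have "\<dots> = complex_of_real (cmod (cinner x y))"
    using False by (simp add: power2_eq_square flip: complex_norm_square)
  finally have "cinner (c *\<^sub>C x) y = complex_of_real (cmod (cinner x y))" .
  then have "cmod (cinner x y) = inner (c *\<^sub>C x) y" by (simp add: inner_eq_Re_cinner)
  also have "\<dots> \<le> norm (c *\<^sub>C x) * norm y" by (rule norm_cauchy_schwarz)
  finally show ?thesis by (simp add: norm_scaleC c)
qed simp

lemma closed_csubspace_subspace:
  assumes "closed_csubspace M"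
  shows "subspace M"
proof (rule subspaceI)
  show "c *\<^sub>R x \<in> M" if "x \<in> M" for c x
    using assms that by (metis closed_csubspace_def scaleC_of_real)
qed (use assms in \<open>auto simp: closed_csubspace_def\<close>)

text \<open>
  A complex subspace contains \<open>\<i> y\<close> along with \<open>y\<close>, and the real parts of \<open>\<langle>z, y\<rangle>\<close> and \<open>\<langle>z, \<i> y\<rangle>\<close>
  determine \<open>\<langle>z, y\<rangle>\<close>. So real and complex orthogonality to it coincide.
\<close>

lemma orth_compl_iff_inner:
  assumes "closed_csubspace M"
  shows "z \<in> orth_compl M \<longleftrightarrow> (\<forall>y\<in>M. inner z y = 0)"
proof
  assume *: "\<forall>y\<in>M. inner z y = 0"
  have "cinner z y = 0" if "y \<in> M" for y
  proof -
    have "\<i> *\<^sub>C y \<in> M" using assms that by (simp add: closed_csubspace_def)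
    then have "Re (cinner z y) = 0" "Re (cinner z (\<i> *\<^sub>C y)) = 0"
      using * that by (auto simp: inner_eq_Re_cinner)
    then show ?thesis by (simp add: cinner_scaleC_right complex_eq_iff)
  qed
  then show "z \<in> orth_compl M" by (simp add: orth_compl_def)
qed (auto simp: orth_compl_def inner_eq_Re_cinner)

lemma orth_proj_eqI:
  assumes M: "closed_csubspace M" and y: "y \<in> M" "x - y \<in> orth_compl M"
  shows "orth_proj M x = y"
  unfolding orth_proj_def
proof (rule the_equality)
  fix z assume z: "z \<in> M \<and> x - z \<in> orth_compl M"
  have yz: "y - z \<in> M" using subspace_diff[OF closed_csubspace_subspace[OF M]] y z by blast
  have "inner (x - z) (y - z) = 0" "inner (x - y) (y - z) = 0"
    using y(2) z yz by (auto simp: orth_compl_iff_inner[OF M])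
  then have "inner (y - z) (y - z) = 0" by (simp add: inner_diff_left)
  then show "z = y" by simp
qed (use y in simp)

lemma orth_proj:
  assumes M: "closed_csubspace M"
  shows orth_proj_in: "orth_proj M x \<in> M"
    and orth_proj_orth: "x - orth_proj M x \<in> orth_compl M"
proof -
  obtain y where "y \<in> M" "\<forall>v\<in>M. inner (x - y) v = 0"
    using orthogonal_decomposition[OF closed_csubspace_subspace[OF M]] M
    unfolding closed_csubspace_def by blast
  then have y: "y \<in> M" "x - y \<in> orth_compl M" by (auto simp: orth_compl_iff_inner[OF M])
  then have "orth_proj M x = y" by (rule orth_proj_eqI[OF M])
  then show "orth_proj M x \<in> M" "x - orth_proj M x \<in> orth_compl M" using y by auto
qed

lemma orth_compl_add: "x \<in> orth_compl M \<Longrightarrow> y \<in> orth_compl M \<Longrightarrow> x + y \<in> orth_compl M"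
  by (simp add: orth_compl_def cinner_add_left)

lemma orth_compl_scaleC: "x \<in> orth_compl M \<Longrightarrow> c *\<^sub>C x \<in> orth_compl M"
  by (simp add: orth_compl_def cinner_scaleC_left)

lemma orth_proj_add:
  assumes M: "closed_csubspace M"
  shows "orth_proj M (x + y) = orth_proj M x + orth_proj M y"
proof (rule orth_proj_eqI[OF M])
  show "orth_proj M x + orth_proj M y \<in> M"
    using orth_proj_in[OF M] M by (simp add: closed_csubspace_def)
  show "x + y - (orth_proj M x + orth_proj M y) \<in> orth_compl M"
    using orth_compl_add[OF orth_proj_orth[OF M, of x] orth_proj_orth[OF M, of y]]
    by (simp add: algebra_simps)
qed

lemma orth_proj_scaleC:
  assumes M: "closed_csubspace M"
  shows "orth_proj M (c *\<^sub>C x) = c *\<^sub>C orth_proj M x"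
proof (rule orth_proj_eqI[OF M])
  show "c *\<^sub>C orth_proj M x \<in> M"
    using orth_proj_in[OF M] M by (simp add: closed_csubspace_def)
  show "c *\<^sub>C x - c *\<^sub>C orth_proj M x \<in> orth_compl M"
    using orth_compl_scaleC[OF orth_proj_orth[OF M, of x], of c] by (simp add: scaleC_diff_right)
qed

lemma orth_proj_fixed_iff:
  assumes M: "closed_csubspace M"
  shows "orth_proj M x = x \<longleftrightarrow> x \<in> M"
proof
  assume "x \<in> M"
  then show "orth_proj M x = x" by (intro orth_proj_eqI[OF M]) (simp_all add: orth_compl_iff_inner[OF M])
qed (metis orth_proj_in[OF M])

lemma orth_proj_eq_0_iff:
  assumes M: "closed_csubspace M"
  shows "orth_proj M x = 0 \<longleftrightarrow> x \<in> orth_compl M"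
proof
  assume "x \<in> orth_compl M"
  then show "orth_proj M x = 0"
    using M by (intro orth_proj_eqI[OF M]) (simp_all add: closed_csubspace_def)
qed (metis orth_proj_orth[OF M] diff_zero)

lemma
  assumes M: "closed_csubspace M"
  shows cinner_orth_proj_left: "cinner (orth_proj M x) y = cinner (orth_proj M x) (orth_proj M y)"
    and cinner_orth_proj_right: "cinner x (orth_proj M y) = cinner (orth_proj M x) (orth_proj M y)"
proof -
  have *: "cinner (u - orth_proj M u) (orth_proj M v) = 0" for u v
    using orth_proj_orth[OF M, of u] orth_proj_in[OF M, of v] by (simp add: orth_compl_def)
  show "cinner x (orth_proj M y) = cinner (orth_proj M x) (orth_proj M y)"
    using *[of x y] by (simp add: cinner_diff_left)
  have "cinner y (orth_proj M x) = cinner (orth_proj M y) (orth_proj M x)"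
    using *[of y x] by (simp add: cinner_diff_left)
  then show "cinner (orth_proj M x) y = cinner (orth_proj M x) (orth_proj M y)"
    using cinner_commute by metis
qed

text \<open>
  Here \<open>P1\<close> and \<open>P2\<close> become the complex-linear projections onto \<open>N1\<close> and \<open>N2\<close>.
\<close>

locale subspace_pair =
  fixes N1 N2 :: "'a :: chilbert_space set"
  assumes csub1: "closed_csubspace N1" and csub2: "closed_csubspace N2"
    and Int_eq_0: "N1 \<inter> N2 = {0}"
begin

sublocale projection_pair "orth_proj N1" "orth_proj N2"
proof (rule projection_pair.intro)
  have *: "linear (orth_proj M)" if "closed_csubspace M" for M :: "'a set"
    by (rule linearI) (metis orth_proj_add[OF that] orth_proj_scaleC[OF that] scaleC_of_real)+
  show "linear (orth_proj N1)" "linear (orth_proj N2)" using * csub1 csub2 by blast+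
  show "orth_proj N1 (orth_proj N1 x) = orth_proj N1 x" for x
    by (simp add: orth_proj_fixed_iff csub1 orth_proj_in)
  show "orth_proj N2 (orth_proj N2 x) = orth_proj N2 x" for x
    by (simp add: orth_proj_fixed_iff csub2 orth_proj_in)
  show "inner (orth_proj N1 x) y = inner x (orth_proj N1 y)" for x y
    unfolding inner_eq_Re_cinner
    by (metis cinner_orth_proj_left[OF csub1] cinner_orth_proj_right[OF csub1])
  show "inner (orth_proj N2 x) y = inner x (orth_proj N2 y)" for x y
    unfolding inner_eq_Re_cinner
    by (metis cinner_orth_proj_left[OF csub2] cinner_orth_proj_right[OF csub2])
  show "x = 0" if "orth_proj N1 x = x" "orth_proj N2 x = x" for x
    using that Int_eq_0 by (auto simp: orth_proj_fixed_iff csub1 csub2)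
qed

abbreviation P1 where "P1 \<equiv> orth_proj N1"
abbreviation P2 where "P2 \<equiv> orth_proj N2"

lemma T_scaleC: "T (c *\<^sub>C x) = c *\<^sub>C T x"
  by (simp add: T_apply orth_proj_scaleC csub1 csub2)

lemma cinner_T: "cinner (T x) y = cinner (P1 x) (P2 y)"
  unfolding T_apply by (metis cinner_orth_proj_left[OF csub2] cinner_orth_proj_right[OF csub2])

subsection \<open>Slow convergence, spectrum and angle\<close>

lemma converges_arbitrarily_slowly_iff: "converges_arbitrarily_slowly_to_0 T \<longleftrightarrow> \<not> separated"
proof
  assume slow: "converges_arbitrarily_slowly_to_0 T"
  show "\<not> separated"
  proof
    assume separated
    then obtain a where "\<forall>n. 0 \<le> a n" "a \<longlonglongrightarrow> (0 :: real)"
      "\<forall>x. \<exists>n\<ge>1. norm ((T ^^ n) x) < a n"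
      using no_slow_orbit by blast
    then show False using slow unfolding converges_arbitrarily_slowly_to_0_def by (meson not_le)
  qed
next
  assume "\<not> separated"
  then show "converges_arbitrarily_slowly_to_0 T"
    unfolding converges_arbitrarily_slowly_to_0_def
    using funpow_product_tendsto_0 slow_orbit by blast
qed

lemma closed_sum_orth_compl_iff:
  "closed {x + y |x y. x \<in> orth_compl N1 \<and> y \<in> orth_compl N2} \<longleftrightarrow> separated"
  using closed_sum_kernels_iff by (simp add: orth_proj_eq_0_iff csub1 csub2)

text \<open>
  With separation, \<open>1 - T\<close> is bounded below by \<open>1 - c\<close> and surjective, so its inverse is bounded.
  Otherwise a bounded inverse would contradict the vectors that \<open>T\<close> almost fixes.
\<close>

lemma one_in_spectrum_iff: "1 \<in> spectrum T \<longleftrightarrow> \<not> separated"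
proof
  assume sp: "1 \<in> spectrum T"
  show "\<not> separated"
  proof
    assume sep: separated
    then obtain c where c: "0 \<le> c" "c < 1" "\<And>x. norm (P2 (P1 x)) \<le> c * norm x"
      unfolding separated_def by blast
    have lower: "(1 - c) * norm x \<le> norm (x - T x)" for x
      using norm_triangle_ineq2[of x "T x"] c(3)[of x] by (simp add: T_apply algebra_simps)
    have inj: "x = y" if "x - T x = y - T y" for x y
    proof -
      have "(x - y) - T (x - y) = (x - T x) - (y - T y)"
        by (simp add: linear_diff[OF linear_product])
      then have "(x - y) - T (x - y) = 0" using that by simp
      then have "(1 - c) * norm (x - y) \<le> 0" using lower[of "x - y"] by simp
      then show ?thesis using c(2) by (simp add: mult_le_0_iff)
    qed
    obtain R where R: "\<And>z. R z - T (R z) = z"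
      using separated_surj[OF sep] unfolding T_apply by metis
    have R_eq: "R (x - T x) = x" for x by (rule inj) (simp add: R)
    have R_add: "R (x + y) = R x + R y" for x y
    proof (rule inj)
      have "R x + R y - T (R x + R y) = (R x - T (R x)) + (R y - T (R y))"
        by (simp add: linear_add[OF linear_product])
      then show "R (x + y) - T (R (x + y)) = R x + R y - T (R x + R y)" by (simp only: R)
    qed
    have R_scaleC: "R (a *\<^sub>C x) = a *\<^sub>C R x" for a x
    proof (rule inj)
      have "a *\<^sub>C R x - T (a *\<^sub>C R x) = a *\<^sub>C (R x - T (R x))"
        by (simp add: T_scaleC scaleC_diff_right)
      then show "R (a *\<^sub>C x) - T (R (a *\<^sub>C x)) = a *\<^sub>C R x - T (a *\<^sub>C R x)" by (simp only: R)
    qed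
    have R_norm: "norm (R x) \<le> norm x * inverse (1 - c)" for x
    proof -
      have "(1 - c) * norm (R x) \<le> norm x" using lower[of "R x"] by (simp only: R)
      then have "norm (R x) \<le> norm x / (1 - c)" using c(2) by (simp add: pos_le_divide_eq mult.commute)
      then show ?thesis by (simp add: divide_inverse)
    qed
    have "bounded_linear R"
      by (rule bounded_linear_intro[OF R_add _ R_norm]) (metis R_scaleC scaleC_of_real)
    then have bl: "bounded_linear (\<lambda>x. - R x)" by (rule bounded_linear_minus)
    have "bounded_clinear (\<lambda>x. - R x)"
      unfolding bounded_clinear_def using bl R_scaleC by (auto simp: scaleC_minus_right)
    moreover have "- R (T x - 1 *\<^sub>C x) = x" for x
    proof -
      have "T x - 1 *\<^sub>C x = (-1) *\<^sub>C (x - T x)" by (simp add: scaleC_minus)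
      then have "R (T x - 1 *\<^sub>C x) = (-1) *\<^sub>C x" by (simp only: R_scaleC R_eq)
      then show ?thesis by (simp add: scaleC_minus)
    qed
    moreover have "T (- R x) - 1 *\<^sub>C (- R x) = x" for x
    proof -
      have "T (- R x) - 1 *\<^sub>C (- R x) = R x - T (R x)"
        by (simp add: linear_neg[OF linear_product])
      then show ?thesis by (simp only: R)
    qed
    ultimately show False using sp unfolding spectrum_def by blast
  qed
next
  assume ns: "\<not> separated"
  show "1 \<in> spectrum T"
  proof (rule ccontr)
    assume "1 \<notin> spectrum T"
    then obtain S where S: "bounded_linear S" "\<And>x. S (T x - x) = x"
      by (auto simp: spectrum_def bounded_clinear_def)
    obtain K where K: "K > 0" "\<And>x. norm (S x) \<le> norm x * K"
      using bounded_linear.pos_bounded[OF S(1)] by blast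
    have "1 / (2 * K) > 0" using K by simp
    then obtain e where e: "P1 e = e" "norm e = 1" "norm (e - P2 e) \<le> 1 / (2 * K)"
      using near_intersection[OF ns] by blast
    have "1 \<le> norm (T e - e) * K" using K(2)[of "T e - e"] S(2)[of e] e(2) by simp
    also have "\<dots> \<le> 1 / (2 * K) * K"
      using e K(1) by (intro mult_right_mono) (simp_all add: T_apply norm_minus_commute)
    finally show False using K(1) by simp
  qed
qed

text \<open>
  The cosine is the norm of \<open>T\<close>, because \<open>\<langle>x, y\<rangle> = \<langle>T x, y\<rangle>\<close> for \<open>x\<close> in \<open>N1\<close> and \<open>y\<close> in \<open>N2\<close>; it is
  nearly attained at \<open>e\<close> and the normalization of \<open>P2 e\<close> when \<open>e\<close> is almost in the intersection.
\<close>

lemma cos_angle_eq_1_iff: "cos_angle N1 N2 = 1 \<longleftrightarrow> \<not> separated"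
proof -
  define S where "S = {cmod (cinner x y) |x y. x \<in> N1 \<and> y \<in> N2 \<and> norm x = 1 \<and> norm y = 1}"
  have cos: "cos_angle N1 N2 = (if S = {} then 0 else Sup S)"
    unfolding cos_angle_def S_def Let_def ..
  have S_le_1: "s \<le> 1" if "s \<in> S" for s
  proof -
    obtain x y :: 'a where "s = cmod (cinner x y)" "norm x = 1" "norm y = 1"
      using \<open>s \<in> S\<close> unfolding S_def by blast
    then show ?thesis using cmod_cinner_le[of x y] by simp
  qed
  show ?thesis
  proof
    assume 1: "cos_angle N1 N2 = 1"
    show "\<not> separated"
    proof
      assume separated
      then obtain c where c: "0 \<le> c" "c < 1" "\<And>x. norm (P2 (P1 x)) \<le> c * norm x"
        unfolding separated_def by blast
      have "s \<le> c" if s: "s \<in> S" for s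
      proof -
        obtain x y where xy: "s = cmod (cinner x y)" "x \<in> N1" "y \<in> N2" "norm x = 1" "norm y = 1"
          using s by (auto simp: S_def)
        have "cinner x y = cinner (T x) y"
          using orth_proj_fixed_iff[OF csub1, of x] orth_proj_fixed_iff[OF csub2, of y] xy
          by (simp add: cinner_T)
        then show ?thesis using cmod_cinner_le[of "T x" y] c(3)[of x] xy by (simp add: T_apply)
      qed
      then have "cos_angle N1 N2 \<le> c"
        unfolding cos using c(1) cSup_least[of S c] by auto
      then show False using 1 c(2) by simp
    qed
  next
    assume ns: "\<not> separated"
    have ex: "\<exists>s\<in>S. 1 - \<delta> \<le> s" if \<delta>: "0 < \<delta>" "\<delta> < 1" for \<delta> :: real
    proof -
      obtain e where e: "P1 e = e" "norm e = 1" "norm (e - P2 e) \<le> \<delta>"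
        using near_intersection[OF ns \<delta>(1)] by blast
      have big: "1 - \<delta> \<le> norm (P2 e)" using norm_triangle_ineq2[of e "P2 e"] e by simp
      then have pos: "norm (P2 e) > 0" using \<delta> by linarith
      define f where "f = complex_of_real (inverse (norm (P2 e))) *\<^sub>C P2 e"
      have "f \<in> N2" unfolding f_def
        using orth_proj_in[OF csub2] csub2 by (simp add: closed_csubspace_def del: of_real_inverse)
      moreover have "norm f = 1" using pos by (simp add: f_def norm_scaleC del: of_real_inverse)
      moreover have "cinner e f = norm (P2 e)"
        using pos
        by (simp add: f_def cinner_scaleC_right cinner_orth_proj_right[OF csub2, of e e] cinner_self
            power2_eq_square)
      moreover have "e \<in> N1" using e(1) by (simp add: orth_proj_fixed_iff csub1)
      ultimately have "norm (P2 e) \<in> S" unfolding S_def using e(2) pos by force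
      then show ?thesis using big by blast
    qed
    have ne: "S \<noteq> {}" using ex[of "1/2"] by auto
    have bdd: "bdd_above S" using S_le_1 by (rule bdd_aboveI)
    have "Sup S \<le> 1" using ne S_le_1 by (rule cSup_least)
    moreover have "1 \<le> Sup S"
    proof (rule field_le_epsilon)
      fix \<delta> :: real assume "0 < \<delta>"
      then have "0 < min \<delta> (1/2)" "min \<delta> (1/2) < 1" by linarith+
      then obtain s where "s \<in> S" "1 - min \<delta> (1/2) \<le> s" using ex by blast
      then show "1 \<le> Sup S + \<delta>" using cSup_upper[OF _ bdd, of s] by linarith
    qed
    ultimately show "cos_angle N1 N2 = 1" using ne by (simp add: cos)
  qed
qed

subsection \<open>The numerical range of a separated pair\<close>

lemma numerical_range_T: "numerical_range T = {cinner (P1 x) (P2 x) |x. norm x = 1}"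
  by (simp add: numerical_range_def cinner_T)

lemma one_in_closure_imp_not_separated:
  assumes "1 \<in> closure (numerical_range T)"
  shows "\<not> separated"
proof
  assume separated
  then obtain c where c: "0 \<le> c" "c < 1" "\<And>x. norm (P2 (P1 x)) \<le> c * norm x"
    unfolding separated_def by blast
  have "w \<in> cball 0 c" if w: "w \<in> numerical_range T" for w
  proof -
    obtain x where x: "norm x = 1" "w = cinner (T x) x"
      using w by (auto simp: numerical_range_def)
    then show ?thesis using cmod_cinner_le[of "T x" x] c(3)[of x] by (simp add: T_apply)
  qed
  then have "closure (numerical_range T) \<subseteq> cball 0 c" by (intro closure_minimal) auto
  then show False using assms c(2) by auto
qed

text \<open>
  Let \<open>u = P1 x\<close>, \<open>v = P2 x\<close> and \<open>y = x - p u - cnj p v\<close> with \<open>p + cnj p = p cnj p = 1\<close>. Expanding gives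
  \<open>\<parallel>y\<parallel>\<^sup>2 = 1 + 2 Re (p\<^sup>2 \<langle>u, v\<rangle>)\<close>, since all terms in \<open>\<parallel>u\<parallel>\<close> and \<open>\<parallel>v\<parallel>\<close> cancel. If \<open>y\<close> were small, then
  so would be \<open>P1 y = cnj p (u - P1 v)\<close> and \<open>P2 y = p (v - P2 u)\<close>. By separation
  \<open>\<parallel>P1 v\<parallel> \<le> c \<parallel>v\<parallel>\<close> and \<open>\<parallel>P2 u\<parallel> \<le> c \<parallel>u\<parallel>\<close>, hence \<open>u\<close> and \<open>v\<close> would be small, and with them the unit
  vector \<open>x\<close>. The two admissible \<open>p\<close> give the two sides of the sector.
\<close>

lemma numerical_range_gap:
  assumes separated
  shows "\<exists>\<eta>>0. \<forall>w\<in>numerical_range T. Re w + sqrt 3 * \<bar>Im w\<bar> \<le> 1 - \<eta>"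
proof -
  obtain c where c: "0 \<le> c" "c < 1" "\<And>x. norm (P2 (P1 x)) \<le> c * norm x"
    using assms unfolding separated_def by blast
  have c12: "norm (P2 (P1 x)) \<le> c * norm (P1 x)" for x
    using c(3)[of "P1 x"] by simp
  \<comment> \<open>The adjoint \<open>P1 P2\<close> of \<open>T\<close> satisfies the same bound.\<close>
  have c21: "norm (P1 (P2 x)) \<le> c * norm (P2 x)" for x
  proof -
    have "(norm (P1 (P2 x)))\<^sup>2 = inner (P2 (P1 (P1 (P2 x)))) x"
      using sym1[of "P2 x" "P1 (P2 x)"] sym2[of x "P1 (P2 x)"]
      by (simp add: power2_norm_eq_inner inner_commute)
    also have "\<dots> = inner (P2 (P1 (P1 (P2 x)))) (P2 x)"
      using sym2[of "P1 (P1 (P2 x))" "P2 x"] sym2[of "P1 (P1 (P2 x))" x] by simp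
    also have "\<dots> \<le> norm (P2 (P1 (P1 (P2 x)))) * norm (P2 x)" by (rule norm_cauchy_schwarz)
    also have "\<dots> \<le> c * norm (P1 (P2 x)) * norm (P2 x)" using c12[of "P1 (P2 x)"]
      by (intro mult_right_mono) auto
    finally have "norm (P1 (P2 x)) * norm (P1 (P2 x)) \<le> norm (P1 (P2 x)) * (c * norm (P2 x))"
      by (simp add: power2_eq_square algebra_simps)
    then show ?thesis using c(1)
      by (cases "P1 (P2 x) = 0") (auto simp: mult_le_cancel_left)
  qed
  \<comment> \<open>The estimates below give \<open>\<parallel>u\<parallel> + \<parallel>v\<parallel> \<le> 2 \<parallel>y\<parallel> / (1 - c)\<close>, so that
    \<open>1 \<le> \<parallel>y\<parallel> + \<parallel>u\<parallel> + \<parallel>v\<parallel>\<close> forces \<open>\<parallel>y\<parallel> \<ge> \<delta>\<close>.\<close>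
  define \<delta> where "\<delta> = (1 - c) / (3 - c)"
  have \<delta>: "\<delta> > 0" using c by (simp add: \<delta>_def)
  have key: "\<delta>\<^sup>2 \<le> 1 + 2 * Re (p\<^sup>2 * cinner (P1 x) (P2 x))"
    if p: "p + cnj p = 1" "p * cnj p = 1" and x: "norm x = 1" for p x
  proof -
    define u v where "u = P1 x" and "v = P2 x"
    define y where "y = x - p *\<^sub>C u - cnj p *\<^sub>C v"
    have cp: "cnj p = 1 - p" using p(1) by (simp add: algebra_simps)
    have np: "cmod p = 1"
    proof -
      have "complex_of_real ((cmod p)\<^sup>2) = 1" using p(2) complex_norm_square[of p] by simp
      then have "(cmod p)\<^sup>2 = 1" by (simp only: of_real_eq_1_iff)
      then show ?thesis by (simp add: power2_eq_1_iff) (metis norm_ge_zero not_one_le_zero neg_0_le_iff_le)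
    qed
    have "P1 y = (1 - p) *\<^sub>C u - cnj p *\<^sub>C P1 v"
      by (simp add: y_def u_def linear_diff[OF lin1] orth_proj_scaleC csub1 scaleC_diff_left)
    then have P1y: "P1 y = cnj p *\<^sub>C (u - P1 v)"
      by (simp add: cp scaleC_diff_right)
    have "P2 y = (1 - cnj p) *\<^sub>C v - p *\<^sub>C P2 u"
      by (simp add: y_def v_def linear_diff[OF lin2] orth_proj_scaleC csub2 scaleC_diff_left)
    then have P2y: "P2 y = p *\<^sub>C (v - P2 u)"
      by (simp add: cp scaleC_diff_right)
    have "norm (u - P1 v) \<le> norm y"
      using norm1[of y] by (simp add: P1y norm_scaleC np)
    then have u: "norm u \<le> c * norm v + norm y"
      using norm_triangle_ineq2[of u "P1 v"] c21[of x] by (simp add: v_def)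
    have "norm (v - P2 u) \<le> norm y"
      using norm2[of y] by (simp add: P2y norm_scaleC np)
    then have v: "norm v \<le> c * norm u + norm y"
      using norm_triangle_ineq2[of v "P2 u"] c12[of x] by (simp add: u_def)
    have "x = (y + p *\<^sub>C u) + cnj p *\<^sub>C v" by (simp add: y_def)
    then have "1 \<le> norm y + norm u + norm v"
      using norm_triangle_ineq[of "y + p *\<^sub>C u" "cnj p *\<^sub>C v"] norm_triangle_ineq[of y "p *\<^sub>C u"] x
      by (simp add: norm_scaleC np)
    then have "(1 - c) * 1 \<le> (1 - c) * (norm y + norm u + norm v)"
      using c(2) by (intro mult_left_mono) auto
    moreover have "(1 - c) * (norm u + norm v) \<le> 2 * norm y" using u v by (simp add: algebra_simps)
    ultimately have "1 - c \<le> (3 - c) * norm y" by (simp add: algebra_simps)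
    then have "\<delta> \<le> norm y" using c by (simp add: \<delta>_def field_simps)
    then have "\<delta>\<^sup>2 \<le> (norm y)\<^sup>2" using \<delta> by (simp add: power_mono)
    also have "(norm y)\<^sup>2 = Re (cinner y y)" by (simp add: cinner_self)
    also have "\<dots> = 1 + 2 * Re (p\<^sup>2 * cinner u v)"
    proof -
      have eqs: "cinner u x = cinner u u" "cinner x u = cinner u u"
        "cinner v x = cinner v v" "cinner x v = cinner v v"
        using cinner_orth_proj_left[OF csub1, of x x] cinner_orth_proj_right[OF csub1, of x x]
          cinner_orth_proj_left[OF csub2, of x x] cinner_orth_proj_right[OF csub2, of x x]
        by (simp_all add: u_def v_def)
      have "cinner y y = cinner x x - (p + cnj p) * cinner u u - (p + cnj p) * cinner v v
          + (p * cnj p) * (cinner u u + cinner v v) + p\<^sup>2 * cinner u v + (cnj p)\<^sup>2 * cinner v u"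
        unfolding y_def cinner_diff_left cinner_diff_right cinner_scaleC_left cinner_scaleC_right eqs
        by (simp add: algebra_simps power2_eq_square)
      also have "\<dots> = 1 + (p\<^sup>2 * cinner u v + cnj (p\<^sup>2 * cinner u v))"
        using cinner_commute[of v u] by (simp add: p x cinner_self)
      finally show ?thesis by (simp only: plus_complex.sel one_complex.sel cnj.sel mult_2)
    qed
    finally show ?thesis by (simp add: u_def v_def)
  qed
  have "Re w + sqrt 3 * \<bar>Im w\<bar> \<le> 1 - \<delta>\<^sup>2" if w: "w \<in> numerical_range T" for w
  proof -
    obtain x where x: "norm x = 1" "w = cinner (P1 x) (P2 x)" using w by (auto simp: numerical_range_T)
    define p where "p = Complex (1/2) (sqrt 3 / 2)"
    have p: "p + cnj p = 1" "p * cnj p = 1" "p\<^sup>2 = Complex (-1/2) (sqrt 3 / 2)"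
      "(cnj p)\<^sup>2 = Complex (-1/2) (- sqrt 3 / 2)"
      by (simp_all add: p_def complex_eq_iff power2_eq_square)
    have "\<delta>\<^sup>2 \<le> 1 + 2 * Re (p\<^sup>2 * w)" using key[of p x] p x by simp
    moreover have "\<delta>\<^sup>2 \<le> 1 + 2 * Re ((cnj p)\<^sup>2 * w)"
      using key[of "cnj p" x] p x by (simp add: add.commute mult.commute)
    ultimately show ?thesis unfolding p(3,4) by (simp add: abs_if)
  qed
  then show ?thesis using \<delta> by (intro exI[of _ "\<delta>\<^sup>2"]) auto
qed

end

section \<open>Elliptic domains and sectors\<close>

lemma focus_in_elliptic_domain:
  assumes "0 \<le> l" "l < 1"
  shows "complex_of_real l \<in> elliptic_domain l"
proof (cases "l = 0")
  case False
  then have "(l - l / 2)\<^sup>2 / (l / 4) = l" by (simp add: power2_eq_square field_simps)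
  then have "(l - l / 2)\<^sup>2 / (l / 4) + 0\<^sup>2 / (l * (1 - l) / 4) \<le> 1" using assms(2) by simp
  then show ?thesis using False assms by (auto simp: elliptic_domain_def complex_of_real_def)
qed (simp add: elliptic_domain_def)

text \<open>
  This is the point where a tangent through \<open>1\<close> touches the ellipse: in coordinates centred at \<open>l/2\<close> the
  polar line of \<open>1\<close> is the vertical line at \<open>(l/4) / (1 - l/2)\<close>.
\<close>

lemma tangent_point_in_elliptic_domain:
  assumes l: "0 < l" "l < 1"
  shows "Complex (1 - (1 - l) * (4 - l) / (2 * (2 - l))) ((1 - l) * sqrt (l * (4 - l)) / (2 * (2 - l)))
    \<in> elliptic_domain l"
proof -
  have "1 - (1 - l) * (4 - l) / (2 * (2 - l)) - l / 2 = l / (2 * (2 - l))"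
    using l by (simp add: field_simps)
  moreover have "(l / (2 * m))\<^sup>2 / (l / 4) = l / m\<^sup>2" for m
    using l by (simp add: power_divide power_mult_distrib power2_eq_square)
  ultimately have "(1 - (1 - l) * (4 - l) / (2 * (2 - l)) - l / 2)\<^sup>2 / (l / 4) = l / (2 - l)\<^sup>2"
    by (simp only:)
  moreover have "((1 - l) * sqrt (l * (4 - l)) / (2 * (2 - l)))\<^sup>2 / (l * (1 - l) / 4)
      = (1 - l) * (4 - l) / (2 - l)\<^sup>2"
  proof -
    have y2: "((1 - l) * sqrt (l * (4 - l)) / (2 * m))\<^sup>2 = (1 - l)\<^sup>2 * (l * (4 - l)) / (4 * m\<^sup>2)" for m
      using l by (simp add: power_divide power_mult_distrib)
    have "n\<^sup>2 * (l * a) / (4 * m\<^sup>2) / (l * n / 4) = n * a / m\<^sup>2" if "n > 0" for n a m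
      using l that by (simp add: power2_eq_square)
    then show ?thesis unfolding y2 using l by simp
  qed
  moreover have "l / (2 - l)\<^sup>2 + (1 - l) * (4 - l) / (2 - l)\<^sup>2 = 1"
  proof -
    have "l + (1 - l) * (4 - l) = (2 - l)\<^sup>2" by (simp add: power2_eq_square algebra_simps)
    then show ?thesis using l by (simp flip: add_divide_distrib)
  qed
  ultimately show ?thesis using l by (auto simp: elliptic_domain_def)
qed

text \<open>
  This is the elliptical range of a \<open>2 \<times> 2\<close> matrix: in terms of \<open>sqrt (1 - l) s\<close> and \<open>sqrt l k\<close>, which
  form a unit vector, the right-hand side is the quadratic form of a matrix with eigenvalues \<open>l\<close> and
  \<open>0\<close>. Taking \<open>k > 0\<close> and \<open>q = l k\<^sup>2\<close>, the second equation is solved for \<open>s\<close>, and the first becomes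
  \<open>\<bar>z - l q\<bar>\<^sup>2 = l (1 - l) q (1 - q)\<close>, a quadratic equation for \<open>q\<close>. Its discriminant is nonnegative
  exactly on the elliptic domain.
\<close>

lemma elliptic_domain_parametrization:
  assumes l: "0 < l" "l < 1" and z: "z \<in> elliptic_domain l"
  obtains s k where "(1 - l) * (cmod s)\<^sup>2 + l * (cmod k)\<^sup>2 = 1"
    "z = of_real l * cnj k * (of_real l * k + of_real (1 - l) * s)"
proof -
  define x y where "x = Re z" and "y = Im z"
  have "(x - l / 2)\<^sup>2 / (l / 4) + y\<^sup>2 / (l * (1 - l) / 4) \<le> 1"
    using z l by (auto simp: elliptic_domain_def x_def y_def)
  then have "l * (1 - l) * ((x - l / 2)\<^sup>2 / (l / 4) + y\<^sup>2 / (l * (1 - l) / 4)) \<le> l * (1 - l) * 1"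
    using l by (intro mult_left_mono) auto
  moreover have "l * (1 - l) * ((x - l / 2)\<^sup>2 / (l / 4) + y\<^sup>2 / (l * (1 - l) / 4))
      = 4 * (1 - l) * (x - l / 2)\<^sup>2 + 4 * y\<^sup>2"
    using l by (simp add: field_simps)
  ultimately have "4 * (1 - l) * (x - l / 2)\<^sup>2 + 4 * y\<^sup>2 \<le> l * (1 - l)" by simp
  moreover have "l * (2 * x + 1 - l)\<^sup>2 - 4 * (x\<^sup>2 + y\<^sup>2)
      = l * (1 - l) - (4 * (1 - l) * (x - l / 2)\<^sup>2 + 4 * y\<^sup>2)"
    by (simp add: power2_eq_square field_simps)
  ultimately have ineq: "4 * (x\<^sup>2 + y\<^sup>2) \<le> l * (2 * x + 1 - l)\<^sup>2" by linarith
  \<comment> \<open>The sum of the two roots is \<open>d\<close>; the larger root is taken, as the smaller one is \<open>0\<close> at \<open>z = 0\<close>.\<close>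
  define d where "d = 2 * x + 1 - l"
  define D where "D = sqrt (d\<^sup>2 - 4 * (x\<^sup>2 + y\<^sup>2) / l)"
  have "4 * (x\<^sup>2 + y\<^sup>2) / l \<le> d\<^sup>2" using ineq l by (simp add: d_def field_simps)
  then have D: "0 \<le> D" "D\<^sup>2 = d\<^sup>2 - 4 * (x\<^sup>2 + y\<^sup>2) / l" by (simp_all add: D_def)
  define q where "q = (d + D) / 2"
  have "q\<^sup>2 - d * q = (D\<^sup>2 - d\<^sup>2) / 4" by (simp add: q_def power2_eq_square field_simps)
  then have root: "l * q\<^sup>2 - l * d * q = - (x\<^sup>2 + y\<^sup>2)"
    using D(2) l by (simp add: field_simps)
  have id: "(x - l * q)\<^sup>2 + y\<^sup>2 = l * (1 - l) * (q * (1 - q))"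
  proof -
    have "(x - l * q)\<^sup>2 + y\<^sup>2 = (x\<^sup>2 + y\<^sup>2) - 2 * l * x * q + (l * q)\<^sup>2"
      by (simp add: power2_eq_square algebra_simps)
    also have "x\<^sup>2 + y\<^sup>2 = l * d * q - l * q\<^sup>2" using root by simp
    finally show ?thesis by (simp add: d_def power2_eq_square algebra_simps)
  qed
  have "0 \<le> l * (1 - l) * (q * (1 - q))" unfolding id[symmetric] by simp
  moreover have "0 < l * (1 - l)" using l by simp
  ultimately have "0 \<le> q * (1 - q)" using zero_le_mult_iff[of "l * (1 - l)" "q * (1 - q)"] by linarith
  then have "0 \<le> q" by (auto simp: zero_le_mult_iff)
  moreover have "q \<noteq> 0"
  proof
    assume "q = 0"
    have "x\<^sup>2 + y\<^sup>2 = l * d * q - l * q\<^sup>2" using root by linarith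
    also have "\<dots> = 0" using \<open>q = 0\<close> by simp
    finally have "x = 0" by (simp only: sum_power2_eq_zero_iff)
    then show False using \<open>q = 0\<close> D(1) l by (simp add: q_def d_def)
  qed
  ultimately have q: "0 < q" by simp
  define k where "k = sqrt (q / l)"
  have k: "0 < k" "k\<^sup>2 = q / l" using q l by (simp_all add: k_def)
  define s where "s = (z - of_real (l * q)) / of_real (l * (1 - l) * k)"
  have "(cmod (z - of_real (l * q)))\<^sup>2 = l * (1 - l) * (q * (1 - q))"
    unfolding id[symmetric] by (simp add: cmod_power2 x_def y_def)
  then have "(cmod s)\<^sup>2 = l * (1 - l) * (q * (1 - q)) / (l * (1 - l) * k)\<^sup>2"
    using l k(1) by (simp add: s_def norm_divide power_divide power_mult_distrib
        del: of_real_mult of_real_diff)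
  also have "\<dots> = (1 - q) / (1 - l)"
  proof -
    have "l * n * (q * (1 - q)) / (l * n * k)\<^sup>2 = (1 - q) / n" if "n > 0" for n
      using l q that by (simp add: power_mult_distrib k(2)) (simp add: power2_eq_square)
    then show ?thesis using l by simp
  qed
  finally have "(1 - l) * (cmod s)\<^sup>2 + l * (cmod (of_real k))\<^sup>2 = 1"
    using l k by simp
  moreover have "z = of_real l * cnj (of_real k) * (of_real l * of_real k + of_real (1 - l) * s)"
  proof -
    have "of_real (l * (1 - l) * k) * s = z - of_real (l * q)"
      using l k(1) by (simp add: s_def)
    then have "z = of_real (l * (1 - l) * k) * s + of_real (l * q)" by (simp only: diff_add_cancel)
    also have "l * q = l * (l * k\<^sup>2)" using l by (simp add: k(2))
    also have "of_real (l * (1 - l) * k) * s + of_real (l * (l * k\<^sup>2))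
        = of_real l * cnj (of_real k) * (of_real l * of_real k + of_real (1 - l) * s)"
      by (simp add: power2_eq_square algebra_simps)
    finally show ?thesis .
  qed
  ultimately show ?thesis using that by blast
qed

text \<open>
  The linear form of the sector condition is closed, so that it passes to the closure of the numerical
  range.
\<close>

lemma sector_imp_cone:
  assumes \<theta>: "0 \<le> \<theta>" "\<theta> < pi / 2" and z: "\<bar>Arg (1 - z)\<bar> \<le> \<theta>"
  shows "\<bar>Im z\<bar> \<le> tan \<theta> * (1 - Re z)"
proof -
  define \<phi> where "\<phi> = Arg (1 - z)"
  define r where "r = cmod (1 - z)"
  have "1 - z = rcis r \<phi>" by (simp add: r_def \<phi>_def rcis_cmod_Arg)
  then have polar: "Re (1 - z) = r * cos \<phi>" "Im (1 - z) = r * sin \<phi>" by simp_all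
  have re: "1 - Re z = r * cos \<bar>\<phi>\<bar>" using polar(1) by (simp add: abs_if)
  have "0 \<le> sin \<bar>\<phi>\<bar>" using z \<theta> by (intro sin_ge_zero) (auto simp: \<phi>_def)
  moreover have "\<bar>sin \<phi>\<bar> = \<bar>sin \<bar>\<phi>\<bar>\<bar>" by (auto simp: abs_if)
  moreover have "\<bar>Im z\<bar> = r * \<bar>sin \<phi>\<bar>"
    using polar(2) by (simp add: r_def abs_mult flip: abs_minus_cancel[of "Im z"])
  ultimately have im: "\<bar>Im z\<bar> = r * sin \<bar>\<phi>\<bar>" by simp
  have "0 < cos \<bar>\<phi>\<bar>" using z \<theta> by (intro cos_gt_zero_pi) (auto simp: \<phi>_def)
  then have "sin \<bar>\<phi>\<bar> = tan \<bar>\<phi>\<bar> * cos \<bar>\<phi>\<bar>" by (simp add: tan_def)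
  also have "\<dots> \<le> tan \<theta> * cos \<bar>\<phi>\<bar>"
    using \<open>0 < cos \<bar>\<phi>\<bar>\<close> z \<theta> by (intro mult_right_mono tan_mono_le) (auto simp: \<phi>_def)
  finally show ?thesis
    using mult_left_mono[of "sin \<bar>\<phi>\<bar>" "tan \<theta> * cos \<bar>\<phi>\<bar>" r] by (simp add: re im r_def mult_ac)
qed

text \<open>
  At the vertex \<open>z = 1\<close> the value \<open>Arg 0 = 0\<close> puts it inside every sector of nonnegative angle. For
  \<open>k = 0\<close> the assumption would not exclude points to the right of the vertex.
\<close>

lemma cone_imp_sector:
  assumes k: "0 < k" and z: "\<bar>Im z\<bar> \<le> k * (1 - Re z)"
  shows "\<bar>Arg (1 - z)\<bar> \<le> arctan k"
proof (cases "z = 1")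
  case True
  then show ?thesis using k by (simp add: Arg_zero)
next
  case False
  have "0 \<le> 1 - Re z" using order_trans[OF abs_ge_zero z] k by (simp add: zero_le_mult_iff)
  moreover have "1 - Re z \<noteq> 0"
  proof
    assume "1 - Re z = 0"
    then show False using z False by (auto simp: complex_eq_iff)
  qed
  ultimately have pos: "0 < 1 - Re z" by simp
  have "- k \<le> - Im z / (1 - Re z)" "- Im z / (1 - Re z) \<le> k"
    unfolding pos_le_divide_eq[OF pos] pos_divide_le_eq[OF pos] using z by (simp_all add: abs_le_iff)
  then have "arctan (- k) \<le> arctan (- Im z / (1 - Re z))" "arctan (- Im z / (1 - Re z)) \<le> arctan k"
    by (simp_all only: arctan_le_iff)
  moreover have "Arg (1 - z) = arctan (- Im z / (1 - Re z))"
    using arg_conv_arctan[of "1 - z"] pos by simp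
  ultimately show ?thesis by (simp add: arctan_minus abs_le_iff)
qed

section \<open>Ellipses in the numerical range and the opening angle at one\<close>

context subspace_pair
begin

text \<open>
  Let \<open>u = P1 e\<close> for an approximate eigenvector \<open>e\<close> and \<open>x = s u + (k - s) P2 u\<close>. Then
  \<open>P2 x = k P2 u\<close> and \<open>P1 x = s u + (k - s) P1 P2 u\<close>, so \<open>\<langle>P1 x, P2 x\<rangle>\<close> and \<open>\<parallel>x\<parallel>\<^sup>2\<close> only involve
  \<open>\<parallel>u\<parallel>\<^sup>2\<close>, \<open>\<parallel>P2 u\<parallel>\<^sup>2\<close> and \<open>\<parallel>P1 P2 u\<parallel>\<^sup>2\<close>, whose limits are \<open>1\<close>, \<open>l\<close> and \<open>l\<^sup>2\<close>. In the limit the quotient is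
  the parametrization of the elliptic domain.
\<close>

lemma elliptic_domain_subset_closure_numerical_range:
  assumes ev: "approx_eigenvalue (\<lambda>x. P1 (P2 (P1 x))) l" and l: "0 < l" "l < 1"
  shows "elliptic_domain l \<subseteq> closure (numerical_range T)"
proof
  fix z assume "z \<in> elliptic_domain l"
  then obtain s k where sk: "(1 - l) * (cmod s)\<^sup>2 + l * (cmod k)\<^sup>2 = 1"
    and z: "z = of_real l * cnj k * (of_real l * k + of_real (1 - l) * s)"
    using elliptic_domain_parametrization[OF l] by metis
  obtain e where e: "(\<lambda>n. (norm (P1 (e n)))\<^sup>2) \<longlonglongrightarrow> 1"
    "(\<lambda>n. (norm (P2 (P1 (e n))))\<^sup>2) \<longlonglongrightarrow> l"
    "(\<lambda>n. (norm (P1 (P2 (P1 (e n)))))\<^sup>2) \<longlonglongrightarrow> l\<^sup>2"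
    using approx_eigenvectors_compression[OF ev l(1)] by metis
  define a where "a = (\<lambda>n. (norm (P1 (e n)))\<^sup>2)"
  define b where "b = (\<lambda>n. (norm (P2 (P1 (e n))))\<^sup>2)"
  define g where "g = (\<lambda>n. (norm (P1 (P2 (P1 (e n)))))\<^sup>2)"
  have lim: "a \<longlonglongrightarrow> 1" "b \<longlonglongrightarrow> l" "g \<longlonglongrightarrow> l\<^sup>2" using e by (simp_all add: a_def b_def g_def)
  define t where "t = k - s"
  define x where "x = (\<lambda>n. s *\<^sub>C P1 (e n) + t *\<^sub>C P2 (P1 (e n)))"
  have w_eq: "cinner (P1 (x n)) (P2 (x n)) = cnj k * (s * of_real (b n) + t * of_real (g n))"
    and n_eq: "of_real ((norm (x n))\<^sup>2)
      = s * cnj s * of_real (a n) + (s * cnj t + t * cnj s + t * cnj t) * of_real (b n)" for n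
  proof -
    define u v where "u = P1 (e n)" and "v = P2 u"
    have uv: "cinner u v = of_real (b n)" "cinner v u = of_real (b n)" "cinner v v = of_real (b n)"
      "cinner u u = of_real (a n)" "cinner (P1 v) v = of_real (g n)"
      using cinner_orth_proj_right[OF csub2, of u u] cinner_orth_proj_left[OF csub2, of u u]
        cinner_orth_proj_left[OF csub1, of v v]
      by (simp_all add: cinner_self a_def b_def g_def u_def v_def)
    have x: "x n = s *\<^sub>C u + t *\<^sub>C v" by (simp add: x_def u_def v_def)
    have "P1 (x n) = s *\<^sub>C u + t *\<^sub>C P1 v"
      by (simp add: x orth_proj_add orth_proj_scaleC csub1) (simp add: u_def)
    moreover have "P2 (x n) = k *\<^sub>C v"
    proof -
      have "P2 (x n) = s *\<^sub>C v + t *\<^sub>C v"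
        by (simp add: x orth_proj_add orth_proj_scaleC csub2) (simp add: v_def)
      then show ?thesis by (simp add: t_def flip: scaleC_add_left)
    qed
    ultimately show "cinner (P1 (x n)) (P2 (x n)) = cnj k * (s * of_real (b n) + t * of_real (g n))"
      by (simp add: cinner_add_left cinner_scaleC_left cinner_scaleC_right uv algebra_simps)
    show "of_real ((norm (x n))\<^sup>2)
      = s * cnj s * of_real (a n) + (s * cnj t + t * cnj s + t * cnj t) * of_real (b n)"
      unfolding cinner_self[symmetric] x
      by (simp add: cinner_add_left cinner_add_right cinner_scaleC_left cinner_scaleC_right uv
          algebra_simps)
  qed
  have "(\<lambda>n. complex_of_real ((norm (x n))\<^sup>2)) \<longlonglongrightarrow>
      s * cnj s * of_real 1 + (s * cnj t + t * cnj s + t * cnj t) * of_real l"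
    unfolding n_eq by (intro tendsto_intros lim)
  also have "s * cnj s * of_real 1 + (s * cnj t + t * cnj s + t * cnj t) * of_real l
      = of_real ((1 - l) * (cmod s)\<^sup>2 + l * (cmod k)\<^sup>2)"
    by (simp add: t_def complex_norm_square algebra_simps del: of_real_power)
  finally have n_lim: "(\<lambda>n. complex_of_real ((norm (x n))\<^sup>2)) \<longlonglongrightarrow> 1" by (simp add: sk)
  have "(\<lambda>n. cinner (P1 (x n)) (P2 (x n)) / of_real ((norm (x n))\<^sup>2)) \<longlonglongrightarrow>
      cnj k * (s * of_real l + t * of_real (l\<^sup>2)) / 1"
    unfolding w_eq by (intro tendsto_intros lim n_lim) simp
  also have "cnj k * (s * of_real l + t * of_real (l\<^sup>2)) / 1 = z"
    by (simp add: z t_def power2_eq_square algebra_simps)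
  finally have w_lim: "(\<lambda>n. cinner (P1 (x n)) (P2 (x n)) / of_real ((norm (x n))\<^sup>2)) \<longlonglongrightarrow> z" .
  have "(\<lambda>n. Re (complex_of_real ((norm (x n))\<^sup>2))) \<longlonglongrightarrow> Re 1" by (intro tendsto_Re n_lim)
  then have "(\<lambda>n. (norm (x n))\<^sup>2) \<longlonglongrightarrow> 1" by simp
  then have "\<forall>\<^sub>F n in sequentially. 0 < (norm (x n))\<^sup>2" by (rule order_tendstoD) simp
  then have "\<forall>\<^sub>F n in sequentially. cinner (P1 (x n)) (P2 (x n)) / of_real ((norm (x n))\<^sup>2)
      \<in> closure (numerical_range T)"
  proof (rule eventually_mono)
    fix n assume "0 < (norm (x n))\<^sup>2"
    then have n0: "0 < norm (x n)" by simp
    define c where "c = complex_of_real (inverse (norm (x n)))"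
    have "norm (c *\<^sub>C x n) = 1" using n0 by (simp add: c_def norm_scaleC del: of_real_inverse)
    then have "cinner (P1 (c *\<^sub>C x n)) (P2 (c *\<^sub>C x n)) \<in> numerical_range T"
      unfolding numerical_range_T by blast
    moreover have "cinner (P1 (c *\<^sub>C x n)) (P2 (c *\<^sub>C x n))
        = cinner (P1 (x n)) (P2 (x n)) / of_real ((norm (x n))\<^sup>2)"
      by (simp add: orth_proj_scaleC csub1 csub2 cinner_scaleC_left cinner_scaleC_right c_def
          power2_eq_square divide_inverse)
    ultimately show "cinner (P1 (x n)) (P2 (x n)) / of_real ((norm (x n))\<^sup>2)
      \<in> closure (numerical_range T)"
      using closure_subset by auto
  qed
  then show "z \<in> closure (numerical_range T)"
    by (rule Lim_in_closed_set[OF closed_closure _ sequentially_bot w_lim])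
qed

lemma not_separated_imp_ellipses:
  assumes ns: "\<not> separated"
  shows "\<exists>l :: nat \<Rightarrow> real. (\<forall>n. 0 < l n \<and> l n < 1) \<and> l \<longlonglongrightarrow> 1 \<and>
       (\<forall>n. elliptic_domain (l n) \<subseteq> closure (numerical_range T))"
proof -
  have "\<exists>l. 1 - inverse (real (Suc n)) < l \<and> l < 1 \<and> approx_eigenvalue (\<lambda>x. P1 (P2 (P1 x))) l" for n
    by (rule approx_eigenvalue_compression[OF ns]) simp
  then obtain l where l: "\<And>n. 1 - inverse (real (Suc n)) < l n" "\<And>n. l n < 1"
    "\<And>n. approx_eigenvalue (\<lambda>x. P1 (P2 (P1 x))) (l n)" by metis
  have pos: "0 < l n" for n
  proof -
    have "inverse (real (Suc n)) \<le> 1" by (simp add: inverse_le_1_iff)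
    then show ?thesis using l(1)[of n] by linarith
  qed
  have "l \<longlonglongrightarrow> 1"
  proof (rule tendsto_sandwich)
    have "(\<lambda>n. 1 - inverse (real (Suc n))) \<longlonglongrightarrow> 1 - 0"
      by (intro tendsto_diff tendsto_const LIMSEQ_inverse_real_of_nat)
    then show "(\<lambda>n. 1 - inverse (real (Suc n))) \<longlonglongrightarrow> 1" by simp
    show "(\<lambda>n. 1 :: real) \<longlonglongrightarrow> 1" by simp
  qed (use l in \<open>auto intro!: always_eventually less_imp_le\<close>)
  then show ?thesis
    using pos l(2) elliptic_domain_subset_closure_numerical_range[OF l(3) pos l(2)] by blast
qed

lemma ellipses_imp_one_in_closure:
  assumes l: "\<And>n. 0 \<le> l n \<and> l n < 1" "l \<longlonglongrightarrow> 1"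
    and sub: "\<And>n. elliptic_domain (l n) \<subseteq> closure (numerical_range T)"
  shows "1 \<in> closure (numerical_range T)"
proof -
  have "(\<lambda>n. complex_of_real (l n)) \<longlonglongrightarrow> of_real 1" by (intro tendsto_of_real l(2))
  moreover have "complex_of_real (l n) \<in> closure (numerical_range T)" for n
    using focus_in_elliptic_domain l(1) sub by blast
  ultimately show ?thesis using closed_sequentially[OF closed_closure] by fastforce
qed

text \<open>
  Since \<open>\<bar>Im w\<bar> \<le> 1\<close> on the numerical range, the gap \<open>\<eta>\<close> can be spent on flattening the sides of the
  cone from slope \<open>1 / sqrt 3\<close> to \<open>1 / (sqrt 3 + \<eta>)\<close>.
\<close>

lemma separated_imp_sector:
  assumes separated
  shows "\<exists>\<theta> < pi / 6. numerical_range T \<subseteq> {z. \<bar>Arg (1 - z)\<bar> \<le> \<theta>}"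
proof -
  obtain \<eta> where \<eta>: "\<eta> > 0" "\<And>w. w \<in> numerical_range T \<Longrightarrow> Re w + sqrt 3 * \<bar>Im w\<bar> \<le> 1 - \<eta>"
    using numerical_range_gap[OF assms] by blast
  define k where "k = 1 / (sqrt 3 + \<eta>)"
  have s: "0 < sqrt 3 + \<eta>" using \<eta>(1) by (simp add: add_nonneg_pos)
  have k: "0 < k" using s by (simp add: k_def)
  have "k < 1 / sqrt 3" using \<eta>(1) s unfolding k_def by (intro divide_strict_left_mono) auto
  then have "arctan k < arctan (tan (pi / 6))" by (simp only: arctan_less_iff tan_30)
  also have "\<dots> = pi / 6" by (rule arctan_tan) auto
  finally have "arctan k < pi / 6" .
  moreover have "\<bar>Arg (1 - w)\<bar> \<le> arctan k" if w: "w \<in> numerical_range T" for w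
  proof (rule cone_imp_sector[OF k])
    obtain x where x: "norm x = 1" "w = cinner (T x) x" using w by (auto simp: numerical_range_def)
    have "cmod w \<le> 1"
      using cmod_cinner_le[of "T x" x] norm_product[of x] x by simp
    then have "\<bar>Im w\<bar> \<le> 1" using abs_Im_le_cmod[of w] by linarith
    then have "\<eta> * \<bar>Im w\<bar> \<le> \<eta>" using \<eta>(1) by simp
    then have "(sqrt 3 + \<eta>) * \<bar>Im w\<bar> \<le> 1 - Re w" using \<eta>(2)[OF w] by (simp add: algebra_simps)
    then show "\<bar>Im w\<bar> \<le> k * (1 - Re w)" using s by (simp add: k_def field_simps)
  qed
  ultimately show ?thesis by blast
qed

text \<open>
  A sector of angle \<open>\<theta>\<close> that contains all the ellipses also contains their tangent points, which forces
  \<open>sqrt (l / (4 - l)) \<le> tan \<theta>\<close> for \<open>l\<close> tending to \<open>1\<close>.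
\<close>

lemma sector_imp_separated:
  assumes \<theta>: "\<theta> < pi / 6" and W: "numerical_range T \<subseteq> {z. \<bar>Arg (1 - z)\<bar> \<le> \<theta>}"
  shows separated
proof (rule ccontr)
  assume "\<not> separated"
  then obtain l where l: "\<And>n. 0 < l n \<and> l n < 1" "l \<longlonglongrightarrow> 1"
    and sub: "\<And>n. elliptic_domain (l n) \<subseteq> closure (numerical_range T)"
    using not_separated_imp_ellipses by blast
  have "elliptic_domain (l 0) \<noteq> {}" using focus_in_elliptic_domain[of "l 0"] l(1)[of 0] by auto
  then obtain w where "w \<in> numerical_range T" using sub[of 0] closure_empty by fastforce
  then have "\<bar>Arg (1 - w)\<bar> \<le> \<theta>" using W by blast
  then have \<theta>0: "0 \<le> \<theta>" by linarith
  define C where "C = {z. \<bar>Im z\<bar> \<le> tan \<theta> * (1 - Re z)}"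
  have "closed C" unfolding C_def by (intro closed_Collect_le continuous_intros)
  moreover have "numerical_range T \<subseteq> C"
    using W sector_imp_cone[OF \<theta>0] \<theta> pi_gt_zero by (auto simp: C_def)
  ultimately have WC: "closure (numerical_range T) \<subseteq> C" by (simp add: closure_minimal)
  have bound: "sqrt (l n * (4 - l n)) \<le> tan \<theta> * (4 - l n)" for n
  proof -
    define r where "r = l n"
    have r: "0 < r" "r < 1" using l(1) by (simp_all add: r_def)
    have "Complex (1 - (1 - r) * (4 - r) / (2 * (2 - r))) ((1 - r) * sqrt (r * (4 - r)) / (2 * (2 - r))) \<in> C"
      using tangent_point_in_elliptic_domain[OF r] sub[of n] WC by (auto simp: r_def)
    then have "(1 - r) * sqrt (r * (4 - r)) / (2 * (2 - r))
        \<le> tan \<theta> * ((1 - r) * (4 - r) / (2 * (2 - r)))"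
      by (simp add: C_def abs_le_iff)
    moreover define m where "m = (1 - r) / (2 * (2 - r))"
    ultimately have "m * sqrt (r * (4 - r)) \<le> m * (tan \<theta> * (4 - r))" by (simp add: mult_ac)
    moreover have "0 < m" using r by (simp add: m_def)
    ultimately show ?thesis by (simp add: r_def)
  qed
  have "(\<lambda>n. sqrt (l n * (4 - l n))) \<longlonglongrightarrow> sqrt (1 * (4 - 1))" by (intro tendsto_intros l(2))
  moreover have "(\<lambda>n. tan \<theta> * (4 - l n)) \<longlonglongrightarrow> tan \<theta> * (4 - 1)" by (intro tendsto_intros l(2))
  ultimately have "sqrt (1 * (4 - 1)) \<le> tan \<theta> * (4 - 1)" using bound by (intro LIMSEQ_le) auto
  then have "sqrt 3 \<le> 3 * tan \<theta>" by simp
  moreover have "tan \<theta> < tan (pi / 6)" using \<theta> \<theta>0 by (intro tan_monotone) auto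
  then have "3 * tan \<theta> < 3 * (1 / sqrt 3)" by (simp add: tan_30)
  then have "3 * tan \<theta> < sqrt 3" by (simp add: real_div_sqrt)
  ultimately show False by simp
qed

end

theorem proposition5p2:
  fixes N1 N2 :: "'a :: chilbert_space set"
  assumes "closed_csubspace N1" and "closed_csubspace N2" and "N1 \<inter> N2 = {0}"
  shows "let T = orth_proj N2 \<circ> orth_proj N1 in all_equivalent
    [converges_arbitrarily_slowly_to_0 T,
     onorm T = 1,
     \<not> closed {x + y |x y. x \<in> orth_compl N1 \<and> y \<in> orth_compl N2},
     1 \<in> spectrum T,
     cos_angle N1 N2 = 1,
     1 \<in> closure (numerical_range T),
     \<exists>l :: nat \<Rightarrow> real. (\<forall>n. 0 \<le> l n \<and> l n < 1) \<and> l \<longlonglongrightarrow> 1 \<and>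
       (\<forall>n. elliptic_domain (l n) \<subseteq> closure (numerical_range T)),
     \<not> (\<exists>\<theta> :: real. \<theta> < pi / 6 \<and> numerical_range T \<subseteq> {z. \<bar>Arg (1 - z)\<bar> \<le> \<theta>})]"
proof -
  interpret subspace_pair N1 N2 using assms by (rule subspace_pair.intro)
  have 7: "\<not> separated \<Longrightarrow> \<exists>l :: nat \<Rightarrow> real. (\<forall>n. 0 \<le> l n \<and> l n < 1) \<and> l \<longlonglongrightarrow> 1 \<and>
       (\<forall>n. elliptic_domain (l n) \<subseteq> closure (numerical_range T))"
    using not_separated_imp_ellipses less_imp_le by metis
  have 6: "1 \<in> closure (numerical_range T)"
    if "\<exists>l :: nat \<Rightarrow> real. (\<forall>n. 0 \<le> l n \<and> l n < 1) \<and> l \<longlonglongrightarrow> 1 \<and>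
       (\<forall>n. elliptic_domain (l n) \<subseteq> closure (numerical_range T))"
    using that ellipses_imp_one_in_closure by blast
  have "1 \<in> closure (numerical_range T) \<longleftrightarrow> \<not> separated"
    using 6 7 one_in_closure_imp_not_separated by blast
  moreover have "(\<exists>l :: nat \<Rightarrow> real. (\<forall>n. 0 \<le> l n \<and> l n < 1) \<and> l \<longlonglongrightarrow> 1 \<and>
       (\<forall>n. elliptic_domain (l n) \<subseteq> closure (numerical_range T))) \<longleftrightarrow> \<not> separated"
    using 6 7 one_in_closure_imp_not_separated by blast
  moreover have "\<not> (\<exists>\<theta> :: real. \<theta> < pi / 6 \<and> numerical_range T \<subseteq> {z. \<bar>Arg (1 - z)\<bar> \<le> \<theta>})
      \<longleftrightarrow> \<not> separated"
    using separated_imp_sector sector_imp_separated by blast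
  ultimately show ?thesis
    unfolding Let_def all_equivalent_def T_def[symmetric] closed_sum_orth_compl_iff
    by (simp add: converges_arbitrarily_slowly_iff onorm_product_eq_1_iff one_in_spectrum_iff
        cos_angle_eq_1_iff)
qed

end
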